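(* Let $\lambda:\mathbb{R}\to(0,\infty)$ be a measurable function such that $1/\lambda$ is locally integrable, and suppose there exist two real numbers $a_+,a_->0$ such that $$\lim_{x\to+\infty}\lambda(x)=a_+ \quad\text{and}\quad \lim_{x\to-\infty}\lambda(x)=a_-.$$ Suppose moreover that there is a constant $c>0$ with $\lambda(x)\ge c$ for all $x\in\mathbb{R}$. Let $B=\{B_t,\,t\ge 0\}$ be a one-dimensional standard Wiener process starting from $0$, let $S_B(u)=\int_0^u \lambda(B_s)^{-1}\,ds$ for $u\ge 0$, and let $\tau_t=\inf\{u>0: S_B(u)>t\}$ for $t\ge 0$. Then on any interval $[0,T]$, $T>0$, the processes $$\left\{\frac{B_{\tau_{nt}}}{\sqrt{n}},\ t\in[0,T]\right\}$$ converge weakly, as $n\to\infty$, to the process $$\left\{W(\eta^{-1}(t)),\ t\in[0,T]\right\},$$ where $W$ is a standard Wiener process starting from $0$, $\eta^{-1}$ is the inverse of the (a.s. continuous and strictly increasing) process $$\eta(t)=\int_0^t\nu(W_s)\,ds,\quad t\ge 0,\qquad\text{and}\qquad \nu(x)=\frac1{a_+}\mathbf 1_{(0,\infty)}(x)+\frac1{a_-}\mathbf 1_{(-\infty,0)}(x).$$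
   Context: Weak convergence on $[0,T]$ means weak convergence of the laws of the continuous stochastic processes, viewed as probability measures on the space $C([0,T])$ of continuous functions with the supremum norm. Convention: $\inf\emptyset=+\infty$. Under the assumptions, $u\mapsto S_B(u)$ is a.s. finite, continuous, strictly increasing and $S_B(\infty)=\infty$ a.s., so that $t\mapsto\tau_t$ is a.s. finite and continuous and $t\mapsto B_{\tau_{nt}}$ has a.s. continuous paths. *)

theory Defs
  imports "HOL-Probability.Probability"
begin

section \<open>Standard Wiener processes\<close>

text \<open>
  Processes are indexed by \<^typ>\<open>real\<close>, but only times \<open>t \<ge> 0\<close> are constrained.
  The starting point and the continuity of paths are required almost surely.
\<close>

definition standard_wiener :: "'a measure \<Rightarrow> (real \<Rightarrow> 'a \<Rightarrow> real) \<Rightarrow> bool" where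
  "standard_wiener M W \<longleftrightarrow>
     prob_space M \<and>
     (\<forall>t\<ge>0. W t \<in> borel_measurable M) \<and>
     (AE \<omega> in M. W 0 \<omega> = 0) \<and>
     (\<forall>s t. 0 \<le> s \<and> s < t \<longrightarrow>
        distributed M lborel (\<lambda>\<omega>. W t \<omega> - W s \<omega>) (normal_density 0 (sqrt (t - s)))) \<and>
     (\<forall>(n::nat) (t :: nat \<Rightarrow> real). 0 \<le> t 0 \<and> (\<forall>i<n. t i \<le> t (Suc i)) \<longrightarrow>
        prob_space.indep_vars M (\<lambda>_. borel) (\<lambda>i \<omega>. W (t (Suc i)) \<omega> - W (t i) \<omega>) {..<n}) \<and>
     (AE \<omega> in M. continuous_on {0..} (\<lambda>t. W t \<omega>))"


section \<open>Weak convergence of continuous processes on a compact interval\<close>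

definition C_metric :: "real \<Rightarrow> (real \<Rightarrow> real) metric" where
  "C_metric T = cfunspace (top_of_set {0..T}) euclidean_metric"

definition borel_of :: "'a topology \<Rightarrow> 'a measure" where
  "borel_of X = sigma (topspace X) {U. openin X U}"

text \<open>
  Elements of \<open>cfunspace\<close> are extensional functions, hence the \<open>restrict\<close>.
  A path which is not continuous is replaced by the zero path; for the processes considered
  below this affects only a null set.
\<close>

definition path_map :: "real \<Rightarrow> (real \<Rightarrow> 'a \<Rightarrow> real) \<Rightarrow> 'a \<Rightarrow> (real \<Rightarrow> real)" where
  "path_map T X \<omega> =
     restrict (if continuous_on {0..T} (\<lambda>t. X t \<omega>) then (\<lambda>t. X t \<omega>) else (\<lambda>_. 0)) {0..T}"

text \<open>
  The underlying space is completed, since paths are continuous only almost surely and the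
  exceptional set need not be measurable.
\<close>

definition continuous_process :: "real \<Rightarrow> 'a measure \<Rightarrow> (real \<Rightarrow> 'a \<Rightarrow> real) \<Rightarrow> bool" where
  "continuous_process T M X \<longleftrightarrow>
     (AE \<omega> in M. continuous_on {0..T} (\<lambda>t. X t \<omega>)) \<and>
     path_map T X \<in> completion M \<rightarrow>\<^sub>M borel_of (mtopology_of (C_metric T))"

definition path_law :: "real \<Rightarrow> 'a measure \<Rightarrow> (real \<Rightarrow> 'a \<Rightarrow> real) \<Rightarrow> (real \<Rightarrow> real) measure" where
  "path_law T M X = distr (completion M) (borel_of (mtopology_of (C_metric T))) (path_map T X)"

definition weak_conv_on :: "'a topology \<Rightarrow> (nat \<Rightarrow> 'a measure) \<Rightarrow> 'a measure \<Rightarrow> bool" where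
  "weak_conv_on X \<mu> \<nu> \<longleftrightarrow>
     (\<forall>f. continuous_map X euclideanreal f \<and> bounded (f ` topspace X) \<longrightarrow>
        (\<lambda>n. \<integral>x. f x \<partial>\<mu> n) \<longlonglongrightarrow> (\<integral>x. f x \<partial>\<nu>))"

definition processes_converge_weakly ::
    "real \<Rightarrow> 'a measure \<Rightarrow> (nat \<Rightarrow> real \<Rightarrow> 'a \<Rightarrow> real) \<Rightarrow> 'b measure \<Rightarrow> (real \<Rightarrow> 'b \<Rightarrow> real) \<Rightarrow> bool"
  where
  "processes_converge_weakly T M X N Y \<longleftrightarrow>
     (\<forall>n. continuous_process T M (X n)) \<and> continuous_process T N Y \<and>
     weak_conv_on (mtopology_of (C_metric T)) (\<lambda>n. path_law T M (X n)) (path_law T N Y)"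


section \<open>The time changes\<close>

definition additive_functional ::
    "(real \<Rightarrow> real) \<Rightarrow> (real \<Rightarrow> 'a \<Rightarrow> real) \<Rightarrow> real \<Rightarrow> 'a \<Rightarrow> real" where
  "additive_functional g W u \<omega> = (LINT s:{0..u}|lborel. g (W s \<omega>))"

text \<open>The infimum is taken in \<^typ>\<open>ereal\<close>, so that the infimum of the empty set is \<open>\<infinity>\<close>.\<close>

definition right_inverse_time :: "(real \<Rightarrow> 'a \<Rightarrow> real) \<Rightarrow> real \<Rightarrow> 'a \<Rightarrow> ereal" where
  "right_inverse_time S t \<omega> = Inf (ereal ` {u. u > 0 \<and> S u \<omega> > t})"

text \<open>
  Below, \<open>real_of_ereal\<close> is applied to the time change; this is harmless where the latter is
  finite, which is almost surely the case.
\<close>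

definition time_changed :: "(real \<Rightarrow> real) \<Rightarrow> (real \<Rightarrow> 'a \<Rightarrow> real) \<Rightarrow> real \<Rightarrow> 'a \<Rightarrow> real" where
  "time_changed lam B t \<omega> =
     B (real_of_ereal (right_inverse_time (additive_functional (\<lambda>x. 1 / lam x) B) t \<omega>)) \<omega>"

definition nu :: "real \<Rightarrow> real \<Rightarrow> real \<Rightarrow> real" where
  "nu a_plus a_minus x =
     1 / a_plus * indicator {0<..} x + 1 / a_minus * indicator {..<0} x"

definition eta :: "real \<Rightarrow> real \<Rightarrow> (real \<Rightarrow> 'a \<Rightarrow> real) \<Rightarrow> real \<Rightarrow> 'a \<Rightarrow> real" where
  "eta a_plus a_minus W = additive_functional (nu a_plus a_minus) W"

definition eta_inv :: "real \<Rightarrow> real \<Rightarrow> (real \<Rightarrow> 'a \<Rightarrow> real) \<Rightarrow> real \<Rightarrow> 'a \<Rightarrow> real" where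
  "eta_inv a_plus a_minus W t \<omega> = the_inv_into {0..} (\<lambda>u. eta a_plus a_minus W u \<omega>) t"

end

theory Submission
  imports Defs
begin

text \<open>
  Why the theorem holds.  For \<open>n \<ge> 1\<close> put \<open>B\<^sup>n\<^sub>s = B\<^bsub>ns\<^esub> / sqrt n\<close>, again a Wiener process, and
  \<open>lam\<^sub>n x = lam (sqrt n * x)\<close>.  Substituting \<open>ns\<close> for \<open>s\<close> in the additive functional shows, path
  by path, that the \<open>n\<close>-th process of the theorem is \<open>B\<^sup>n\<close> run with speed \<open>lam\<^sub>n\<close>
  (\<open>time_changed_scaling\<close>).  Since \<open>B\<^sup>n\<close> and \<open>W\<close> have the same law, it has the law of \<open>W\<close> run with
  speed \<open>lam\<^sub>n\<close>, so that all processes, and the limit, may be taken on one probability space and built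
  from the single path \<open>W\<close>.  There they converge almost surely.

  Indeed \<open>1 / lam\<^sub>n\<close> tends to \<open>nu\<close> away from \<open>0\<close>, and a Wiener path spends no time at \<open>0\<close>
  (\<open>wiener_ae_nonzero\<close>); as \<open>1 / lam\<^sub>n \<le> 1 / c\<close>, dominated convergence gives
  \<open>S\<^sub>n u \<longlonglongrightarrow> eta u\<close> for the clocks \<open>S\<^sub>n u = \<integral> 1 / lam\<^sub>n (W\<^sub>s) ds\<close> over \<open>{0..u}\<close>.  Clocks are continuous,
  strictly increasing and unbounded, and for such functions pointwise convergence forces the inverses
  to converge along convergent sequences of times (\<open>clock_inv_tendsto\<close>).  Composed with the continuous path
  \<open>W\<close> and read on the compact interval \<open>{0..T}\<close>, this is uniform convergence
  (\<open>time_changed_uniform_limit\<close>), and bounded convergence gives the convergence of \<open>\<integral> F\<close> for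
  continuous bounded \<open>F\<close>.

  The same scaling shows that the clock of \<open>B\<close> is unbounded: the expectation of \<open>exp (- S\<^sub>B n)\<close>
  equals that of \<open>exp (- n * S\<^sub>n 1)\<close>, which tends to \<open>0\<close> because \<open>S\<^sub>n 1 \<longlonglongrightarrow> eta 1 > 0\<close>
  (\<open>occupation_clock_unbounded\<close>).

  Transferring a statement from \<open>B\<^sup>n\<close> to \<open>W\<close> requires the law of a Wiener process
  and functionals that are measurable for it.  The law is taken on the product
  space of all real functions on \<open>{0..}\<close>, where it is determined by the finite-dimensional
  distributions (\<open>wiener_law_unique\<close>).  Continuous paths do not form a measurable subset there, so two
  limits replace evaluation: \<open>dyadic_eval\<close> recovers a continuous path from its values at dyadic times and is
  jointly measurable in time and path, and \<open>sampled_value T F\<close> recovers the value of a continuous \<open>F\<close>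
  from Bernstein polynomials with rounded coefficients, of which there are only countably many.
  Both are measurable on the whole product space and have the intended value at continuous paths.
\<close>


section \<open>The law of a Wiener process on path space\<close>

lemma standard_wiener_prob_space: "standard_wiener M W \<Longrightarrow> prob_space M"
  by (simp add: standard_wiener_def)

lemma standard_wiener_measurable: "standard_wiener M W \<Longrightarrow> 0 \<le> t \<Longrightarrow> W t \<in> borel_measurable M"
  by (simp add: standard_wiener_def)

lemma standard_wiener_start: "standard_wiener M W \<Longrightarrow> AE \<omega> in M. W 0 \<omega> = 0"
  by (simp add: standard_wiener_def)

lemma standard_wiener_increment:
  "standard_wiener M W \<Longrightarrow> 0 \<le> s \<Longrightarrow> s < t \<Longrightarrow>
    distributed M lborel (\<lambda>\<omega>. W t \<omega> - W s \<omega>) (normal_density 0 (sqrt (t - s)))"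
  by (simp add: standard_wiener_def)

lemma standard_wiener_indep:
  fixes t :: "nat \<Rightarrow> real"
  shows "standard_wiener M W \<Longrightarrow> 0 \<le> t 0 \<Longrightarrow> (\<And>i. i < n \<Longrightarrow> t i \<le> t (Suc i)) \<Longrightarrow>
    prob_space.indep_vars M (\<lambda>_. borel) (\<lambda>i \<omega>. W (t (Suc i)) \<omega> - W (t i) \<omega>) {..<n}"
  by (simp add: standard_wiener_def)

lemma standard_wiener_continuous:
  "standard_wiener M W \<Longrightarrow> AE \<omega> in M. continuous_on {0..} (\<lambda>t. W t \<omega>)"
  by (simp add: standard_wiener_def)

lemma nonneg_of_increasing:
  fixes t :: "nat \<Rightarrow> real"
  assumes "0 \<le> t 0" "\<And>i. i < n \<Longrightarrow> t i < t (Suc i)" "i \<le> n"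
  shows "0 \<le> t i"
  using assms(3)
proof (induction i)
  case (Suc i)
  with assms(2)[of i] show ?case by simp
qed (use assms in simp)

lemma wiener_increments_law:
  fixes t :: "nat \<Rightarrow> real"
  assumes W: "standard_wiener M W" and t0: "0 \<le> t 0" and t: "\<And>i. i < n \<Longrightarrow> t i < t (Suc i)" and n: "0 < n"
  shows "distr M (\<Pi>\<^sub>M i\<in>{..<n}. borel) (\<lambda>\<omega>. \<lambda>i\<in>{..<n}. W (t (Suc i)) \<omega> - W (t i) \<omega>)
    = (\<Pi>\<^sub>M i\<in>{..<n}. density lborel (normal_density 0 (sqrt (t (Suc i) - t i))))"
proof -
  interpret prob_space M using standard_wiener_prob_space[OF W] .
  have pos: "0 \<le> t i" if "i \<le> n" for i
    using nonneg_of_increasing[of t n i] t0 t that by blast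
  have meas: "W (t i) \<in> borel_measurable M" if "i \<le> n" for i
    using standard_wiener_measurable[OF W pos[OF that]] .
  have "indep_vars (\<lambda>_. borel) (\<lambda>i \<omega>. W (t (Suc i)) \<omega> - W (t i) \<omega>) {..<n}"
    by (rule standard_wiener_indep[OF W, of t]) (use t t0 in \<open>auto intro: less_imp_le\<close>)
  then have "distr M (\<Pi>\<^sub>M i\<in>{..<n}. borel) (\<lambda>\<omega>. \<lambda>i\<in>{..<n}. W (t (Suc i)) \<omega> - W (t i) \<omega>)
      = (\<Pi>\<^sub>M i\<in>{..<n}. distr M borel (\<lambda>\<omega>. W (t (Suc i)) \<omega> - W (t i) \<omega>))"
    by (subst (asm) indep_vars_iff_distr_eq_PiM') (use n meas in \<open>auto intro!: borel_measurable_diff\<close>)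
  also have "\<dots> = (\<Pi>\<^sub>M i\<in>{..<n}. density lborel (normal_density 0 (sqrt (t (Suc i) - t i))))"
  proof (rule PiM_cong[OF refl])
    fix i assume "i \<in> {..<n}"
    then have "distributed M lborel (\<lambda>\<omega>. W (t (Suc i)) \<omega> - W (t i) \<omega>) (normal_density 0 (sqrt (t (Suc i) - t i)))"
      by (intro standard_wiener_increment[OF W]) (use t pos in auto)
    then have "distr M lborel (\<lambda>\<omega>. W (t (Suc i)) \<omega> - W (t i) \<omega>) = density lborel (normal_density 0 (sqrt (t (Suc i) - t i)))"
      by (simp add: distributed_def)
    moreover have "distr M borel (\<lambda>\<omega>. W (t (Suc i)) \<omega> - W (t i) \<omega>) = distr M lborel (\<lambda>\<omega>. W (t (Suc i)) \<omega> - W (t i) \<omega>)"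
      by (rule distr_cong) simp_all
    ultimately show "distr M borel (\<lambda>\<omega>. W (t (Suc i)) \<omega> - W (t i) \<omega>) = density lborel (normal_density 0 (sqrt (t (Suc i) - t i)))"
      by simp
  qed
  finally show ?thesis .
qed

text \<open>
  The value of the process at \<open>t k\<close> is almost surely the sum of the first \<open>k\<close> increments, because the
  process starts at \<open>0\<close>.  The right-hand side mentions neither \<open>M\<close> nor \<open>W\<close>, which makes the
  marginals of any two Wiener processes comparable.
\<close>

lemma wiener_marginal_law:
  fixes t :: "nat \<Rightarrow> real"
  assumes W: "standard_wiener M W" and t0: "t 0 = 0" and t: "\<And>i. i < n \<Longrightarrow> t i < t (Suc i)" and n: "0 < n"
    and J: "J \<subseteq> t ` {..n}"
  shows "distr M (\<Pi>\<^sub>M j\<in>J. borel) (\<lambda>\<omega>. \<lambda>j\<in>J. W j \<omega>)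
    = distr (\<Pi>\<^sub>M i\<in>{..<n}. density lborel (normal_density 0 (sqrt (t (Suc i) - t i)))) (\<Pi>\<^sub>M j\<in>J. borel)
        (\<lambda>x :: nat \<Rightarrow> real. \<lambda>j\<in>J. \<Sum>i | i < n \<and> t i < j. x i)"
proof -
  have pos: "0 \<le> t i" if "i \<le> n" for i
    using nonneg_of_increasing[of t n i] t0 t that by simp
  have tmono: "t i < t j" if "i < j" "j \<le> n" for i j
    using that
  proof (induction j)
    case (Suc j)
    then show ?case using t[of j] by (cases "i = j") auto
  qed simp
  let ?inc = "\<lambda>\<omega>. \<lambda>i\<in>{..<n}. W (t (Suc i)) \<omega> - W (t i) \<omega>"
  let ?Psi = "\<lambda>x :: nat \<Rightarrow> real. \<lambda>j\<in>J. \<Sum>i | i < n \<and> t i < j. x i"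
  have [measurable]: "?Psi \<in> (\<Pi>\<^sub>M i\<in>{..<n}. borel) \<rightarrow>\<^sub>M (\<Pi>\<^sub>M j\<in>J. borel)"
  proof (rule measurable_restrict)
    fix j assume "j \<in> J"
    show "(\<lambda>x :: nat \<Rightarrow> real. \<Sum>i | i < n \<and> t i < j. x i) \<in> borel_measurable (\<Pi>\<^sub>M i\<in>{..<n}. borel)"
      by (rule borel_measurable_sum) (auto intro: measurable_component_singleton)
  qed
  have meas: "W (t i) \<in> borel_measurable M" if "i \<le> n" for i
    using standard_wiener_measurable[OF W pos[OF that]] .
  have measJ: "W j \<in> borel_measurable M" if "j \<in> J" for j
    using J that meas by auto
  have inc: "?inc \<in> M \<rightarrow>\<^sub>M (\<Pi>\<^sub>M i\<in>{..<n}. borel)"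
    by (intro measurable_restrict borel_measurable_diff meas) auto
  have "distr M (\<Pi>\<^sub>M j\<in>J. borel) (\<lambda>\<omega>. \<lambda>j\<in>J. W j \<omega>) = distr M (\<Pi>\<^sub>M j\<in>J. borel) (\<lambda>\<omega>. ?Psi (?inc \<omega>))"
  proof (rule distr_cong_AE[OF refl refl])
    show "AE \<omega> in M. (\<lambda>j\<in>J. W j \<omega>) = ?Psi (?inc \<omega>)"
      using standard_wiener_start[OF W]
    proof eventually_elim
      case (elim \<omega>)
      show ?case
      proof (rule restrict_ext)
        fix j assume "j \<in> J"
        then obtain k where k: "k \<le> n" "j = t k" using J by auto
        have "{i. i < n \<and> t i < j} = {..<k}"
          using k tmono by (auto) (metis le_eq_less_or_eq less_le_not_le linorder_not_less)
        then have "(\<Sum>i | i < n \<and> t i < j. ?inc \<omega> i) = (\<Sum>i<k. W (t (Suc i)) \<omega> - W (t i) \<omega>)"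
          using k by (intro sum.cong) auto
        also have "\<dots> = W j \<omega>"
          using elim t0 k sum_lessThan_telescope[of "\<lambda>i. W (t i) \<omega>" k] by simp
        finally show "W j \<omega> = (\<Sum>i | i < n \<and> t i < j. ?inc \<omega> i)" by simp
      qed
    qed
    show "(\<lambda>\<omega>. \<lambda>j\<in>J. W j \<omega>) \<in> M \<rightarrow>\<^sub>M (\<Pi>\<^sub>M j\<in>J. borel)"
      by (intro measurable_restrict measJ)
    show "(\<lambda>\<omega>. ?Psi (?inc \<omega>)) \<in> M \<rightarrow>\<^sub>M (\<Pi>\<^sub>M j\<in>J. borel)"
      by (rule measurable_compose[OF inc]) measurable
  qed
  also have "\<dots> = distr (distr M (\<Pi>\<^sub>M i\<in>{..<n}. borel) ?inc) (\<Pi>\<^sub>M j\<in>J. borel) ?Psi"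
    using inc by (subst distr_distr) (auto simp: comp_def)
  also have "distr M (\<Pi>\<^sub>M i\<in>{..<n}. borel) ?inc = (\<Pi>\<^sub>M i\<in>{..<n}. density lborel (normal_density 0 (sqrt (t (Suc i) - t i))))"
    by (rule wiener_increments_law[OF W, of t]) (use t t0 n in auto)
  finally show ?thesis .
qed

text \<open>
  Outside \<open>{0..}\<close> the paths are arbitrary, hence the restriction.
\<close>

definition path_of :: "(real \<Rightarrow> 'a \<Rightarrow> real) \<Rightarrow> 'a \<Rightarrow> real \<Rightarrow> real" where
  "path_of W \<omega> = (\<lambda>s\<in>{0..}. W s \<omega>)"

abbreviation path_space :: "(real \<Rightarrow> real) measure" where
  "path_space \<equiv> \<Pi>\<^sub>M s\<in>{0..}. borel"

lemma path_of_measurable: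
  "standard_wiener M W \<Longrightarrow> path_of W \<in> M \<rightarrow>\<^sub>M path_space"
  unfolding path_of_def[abs_def] by (intro measurable_restrict standard_wiener_measurable) auto

text \<open>
  A finite measure on a product space is determined by its values on cylinders.  To describe the marginal on a
  finite set \<open>J\<close> of times, \<open>J\<close> is enlarged by \<open>0\<close>, where the process is known, and by \<open>1\<close>, which
  guarantees that there is at least one increment, and is then listed in increasing order.
\<close>

lemma wiener_law_unique:
  assumes W: "standard_wiener M W" and B: "standard_wiener N B"
  shows "distr M path_space (path_of W) = distr N path_space (path_of B)"
proof (rule measure_eqI_PiM_infinite)
  interpret M: prob_space M using standard_wiener_prob_space[OF W] .
  show "finite_measure (distr M path_space (path_of W))"
    by (intro prob_space.finite_measure M.prob_space_distr path_of_measurable[OF W])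
  fix A :: "real \<Rightarrow> real set" and J :: "real set"
  assume J: "finite J" "J \<subseteq> {0..}" and A: "\<And>i. i \<in> J \<Longrightarrow> A i \<in> sets borel"
  define xs where "xs = sorted_list_of_set (insert 0 (insert 1 J))"
  define n where "n = length xs - 1"
  have set: "set xs = insert 0 (insert 1 J)" unfolding xs_def using J by (intro set_sorted_list_of_set) auto
  have sorted: "sorted_wrt (<) xs" unfolding xs_def by (rule strict_sorted_list_of_set)
  have len: "length xs = card (insert 0 (insert 1 J))" by (simp add: xs_def)
  have "card {0, 1::real} \<le> card (insert 0 (insert 1 J))" using J by (intro card_mono) auto
  then have len2: "2 \<le> length xs" unfolding len by simp
  then have n: "0 < n" by (simp add: n_def)
  have mono: "xs ! i < xs ! j" if "i < j" "j \<le> n" for i j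
    using sorted_wrt_nth_less[OF sorted] that len2 by (simp add: n_def)
  have Jn: "J \<subseteq> (!) xs ` {..n}"
  proof
    fix j assume "j \<in> J"
    then have "j \<in> set xs" using set by auto
    then obtain i where "i < length xs" "xs ! i = j" by (auto simp: in_set_conv_nth)
    then show "j \<in> (!) xs ` {..n}" by (auto simp: n_def intro!: image_eqI[of _ _ i])
  qed
  have "0 \<in> set xs" using set by auto
  then obtain i where i: "i < length xs" "xs ! i = 0" by (auto simp: in_set_conv_nth)
  have "xs ! 0 \<in> set xs" using len2 by (intro nth_mem) auto
  then have "xs ! 0 \<ge> 0" using set J by auto
  moreover have "i \<le> n" using i by (simp add: n_def)
  ultimately have z: "xs ! 0 = 0" using mono[of 0 i] i by (cases "i = 0") auto
  have t: "xs ! i < xs ! Suc i" if "i < n" for i using mono that by simp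
  have law: "distr M (\<Pi>\<^sub>M j\<in>J. borel) (\<lambda>\<omega>. \<lambda>j\<in>J. W j \<omega>) = distr N (\<Pi>\<^sub>M j\<in>J. borel) (\<lambda>\<omega>. \<lambda>j\<in>J. B j \<omega>)"
    by (simp add: wiener_marginal_law[OF W z t n Jn] wiener_marginal_law[OF B z t n Jn])
  have eq: "emeasure (distr M path_space (path_of W)) (prod_emb {0..} (\<lambda>_. borel) J (Pi\<^sub>E J A))
      = emeasure (distr M (\<Pi>\<^sub>M j\<in>J. borel) (\<lambda>\<omega>. \<lambda>j\<in>J. W j \<omega>)) (Pi\<^sub>E J A)"
    if W: "standard_wiener M W" for M :: "'z measure" and W :: "real \<Rightarrow> 'z \<Rightarrow> real"
  proof -
    have cyl: "prod_emb {0..} (\<lambda>_. borel) J (Pi\<^sub>E J A) \<in> sets path_space"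
      using J A by (intro sets_PiM_I) auto
    have box: "Pi\<^sub>E J A \<in> sets (\<Pi>\<^sub>M j\<in>J. borel)"
      using J A by (intro sets_PiM_I_finite) auto
    have mJ: "(\<lambda>\<omega>. \<lambda>j\<in>J. W j \<omega>) \<in> M \<rightarrow>\<^sub>M (\<Pi>\<^sub>M j\<in>J. borel)"
      using J by (intro measurable_restrict standard_wiener_measurable[OF W]) auto
    have "path_of W \<omega> \<in> prod_emb {0..} (\<lambda>_. borel) J (Pi\<^sub>E J A) \<longleftrightarrow> (\<lambda>j\<in>J. W j \<omega>) \<in> Pi\<^sub>E J A" for \<omega>
    proof -
      have "restrict (path_of W \<omega>) J = (\<lambda>j\<in>J. W j \<omega>)"
        using J(2) by (auto simp: path_of_def fun_eq_iff)
      then show ?thesis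
        by (simp add: prod_emb_def path_of_def)
    qed
    then have "path_of W -` prod_emb {0..} (\<lambda>_. borel) J (Pi\<^sub>E J A) \<inter> space M
      = (\<lambda>\<omega>. \<lambda>j\<in>J. W j \<omega>) -` Pi\<^sub>E J A \<inter> space M"
      by auto
    then show ?thesis
      by (simp add: emeasure_distr[OF path_of_measurable[OF W] cyl] emeasure_distr[OF mJ box])
  qed
  show "emeasure (distr M path_space (path_of W)) (prod_emb {0..} (\<lambda>_. borel) J (Pi\<^sub>E J A))
      = emeasure (distr N path_space (path_of B)) (prod_emb {0..} (\<lambda>_. borel) J (Pi\<^sub>E J A))"
    using eq[OF W] eq[OF B] law by simp
qed simp_all

lemma wiener_integral_unique:
  fixes \<Phi> :: "(real \<Rightarrow> real) \<Rightarrow> real"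
  assumes W: "standard_wiener M W" and B: "standard_wiener N B" and \<Phi>: "\<Phi> \<in> borel_measurable path_space"
  shows "(\<integral>\<omega>. \<Phi> (path_of W \<omega>) \<partial>M) = (\<integral>\<omega>. \<Phi> (path_of B \<omega>) \<partial>N)"
  using wiener_law_unique[OF W B]
    integral_distr[OF path_of_measurable[OF W] \<Phi>] integral_distr[OF path_of_measurable[OF B] \<Phi>] by simp


section \<open>Brownian scaling\<close>

lemma wiener_scaling:
  assumes W: "standard_wiener M W" and a: "0 < a"
  shows "standard_wiener M (\<lambda>s \<omega>. W (a * s) \<omega> / sqrt a)"
  unfolding standard_wiener_def
proof (intro conjI allI impI)
  interpret prob_space M using standard_wiener_prob_space[OF W] .
  show "prob_space M" by (rule standard_wiener_prob_space[OF W])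
  show "(\<lambda>\<omega>. W (a * t) \<omega> / sqrt a) \<in> borel_measurable M" if "0 \<le> t" for t
    using standard_wiener_measurable[OF W, of "a * t"] a that by simp
  show "AE \<omega> in M. W (a * 0) \<omega> / sqrt a = 0"
    using standard_wiener_start[OF W] by simp
  show "AE \<omega> in M. continuous_on {0..} (\<lambda>t. W (a * t) \<omega> / sqrt a)"
    using standard_wiener_continuous[OF W]
  proof eventually_elim
    case (elim \<omega>)
    have "continuous_on {0..} (\<lambda>t. W (a * t) \<omega>)"
      by (rule continuous_on_compose2[OF elim]) (use a in \<open>auto intro!: continuous_intros\<close>)
    then show ?case using a by (intro continuous_intros) auto
  qed
  show "distributed M lborel (\<lambda>\<omega>. W (a * t) \<omega> / sqrt a - W (a * s) \<omega> / sqrt a)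
      (normal_density 0 (sqrt (t - s)))" if "0 \<le> s \<and> s < t" for s t
  proof -
    have d: "distributed M lborel (\<lambda>\<omega>. W (a * t) \<omega> - W (a * s) \<omega>) (normal_density 0 (sqrt (a * t - a * s)))"
      by (rule standard_wiener_increment[OF W]) (use a that in auto)
    have sd: "\<bar>1 / sqrt a\<bar> * sqrt (a * t - a * s) = sqrt (t - s)"
      using a by (simp add: right_diff_distrib[symmetric] real_sqrt_mult)
    have *: "(\<lambda>\<omega>. 0 + 1 / sqrt a * (W (a * t) \<omega> - W (a * s) \<omega>)) = (\<lambda>\<omega>. W (a * t) \<omega> / sqrt a - W (a * s) \<omega> / sqrt a)"
      by (simp add: diff_divide_distrib)
    show ?thesis
      using normal_density_affine[OF d, of "1 / sqrt a" 0] a that unfolding * sd by simp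
  qed
  show "indep_vars (\<lambda>_. borel) (\<lambda>i \<omega>. W (a * t (Suc i)) \<omega> / sqrt a - W (a * t i) \<omega> / sqrt a) {..<n}"
    if "0 \<le> t 0 \<and> (\<forall>i<n. t i \<le> t (Suc i))" for n :: nat and t :: "nat \<Rightarrow> real"
  proof -
    have "indep_vars (\<lambda>_. borel) (\<lambda>i \<omega>. W (a * t (Suc i)) \<omega> - W (a * t i) \<omega>) {..<n}"
      by (rule standard_wiener_indep[OF W, of "\<lambda>i. a * t i"]) (use a that in auto)
    from indep_vars_compose2[OF this, of "\<lambda>_ x. x / sqrt a" "\<lambda>_. borel"]
    show ?thesis by (simp add: diff_divide_distrib)
  qed
qed

text \<open>
  Substitution of \<open>a * s\<close> for \<open>s\<close>.  The factor \<open>sqrt a\<close> inside the rate undoes the spatial scaling, so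
  that the integrand remains \<open>k (W (a * s) \<omega>)\<close>.
\<close>

lemma additive_functional_scaling:
  assumes a: "0 < a"
  shows "additive_functional k W (a * u) \<omega>
    = a * additive_functional (\<lambda>x. k (sqrt a * x)) (\<lambda>s \<omega>. W (a * s) \<omega> / sqrt a) u \<omega>"
proof -
  have "additive_functional k W (a * u) \<omega> = a * (LINT s|lborel. indicator {0..a * u} (0 + a * s) *\<^sub>R k (W (0 + a * s) \<omega>))"
    unfolding additive_functional_def set_lebesgue_integral_def
    by (subst lborel_integral_real_affine[of a _ 0]) (use a in auto)
  also have "(LINT s|lborel. indicator {0..a * u} (0 + a * s) *\<^sub>R k (W (0 + a * s) \<omega>))
      = additive_functional (\<lambda>x. k (sqrt a * x)) (\<lambda>s \<omega>. W (a * s) \<omega> / sqrt a) u \<omega>"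
    unfolding additive_functional_def set_lebesgue_integral_def
    by (rule Bochner_Integration.integral_cong) (use a in \<open>auto simp: indicator_def zero_le_mult_iff\<close>)
  finally show ?thesis .
qed

text \<open>
  By the preceding substitution the clocks satisfy \<open>S (a * u) = a * R u\<close>.  Hence the set of times \<open>u\<close>
  with \<open>S u > a * t\<close> is \<open>a\<close> times the set of times \<open>v\<close> with \<open>R v > t\<close>, and the infima are related
  in the same way.  This holds for every path, including those whose clock is bounded.
\<close>

lemma time_changed_scaling:
  assumes a: "0 < a"
  shows "time_changed g B (a * t) \<omega> / sqrt a
    = time_changed (\<lambda>x. g (sqrt a * x)) (\<lambda>s \<omega>. B (a * s) \<omega> / sqrt a) t \<omega>"
proof -
  let ?S = "additive_functional (\<lambda>x. 1 / g x) B"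
  let ?R = "additive_functional (\<lambda>x. 1 / g (sqrt a * x)) (\<lambda>s \<omega>. B (a * s) \<omega> / sqrt a)"
  have sc: "?S (a * u) \<omega> = a * ?R u \<omega>" for u
    by (rule additive_functional_scaling[OF a])
  have "{u. 0 < u \<and> a * t < ?S u \<omega>} = (*) a ` {v. 0 < v \<and> t < ?R v \<omega>}"
  proof safe
    fix u assume u: "0 < u" "a * t < ?S u \<omega>"
    then show "u \<in> (*) a ` {v. 0 < v \<and> t < ?R v \<omega>}"
      using a sc[of "u / a"] by (intro image_eqI[of _ _ "u / a"]) auto
  qed (use a sc in auto)
  then have "ereal ` {u. 0 < u \<and> a * t < ?S u \<omega>} = (\<lambda>x. ereal a * x) ` ereal ` {v. 0 < v \<and> t < ?R v \<omega>}"
    by (simp only: image_image times_ereal.simps)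
  also have "\<dots> = {ereal a * x | x. x \<in> ereal ` {v. 0 < v \<and> t < ?R v \<omega>}}"
    by blast
  finally have "right_inverse_time ?S (a * t) \<omega> = Inf {ereal a * x | x. x \<in> ereal ` {v. 0 < v \<and> t < ?R v \<omega>}}"
    unfolding right_inverse_time_def by (rule arg_cong[where f=Inf])
  also have "\<dots> = ereal a * right_inverse_time ?R t \<omega>"
    unfolding right_inverse_time_def by (subst ereal_Inf_cmult[OF a]) simp
  finally show ?thesis by (simp add: time_changed_def)
qed


section \<open>Measurability of the time change as a function of the path\<close>

text \<open>
  A version of the evaluation map that is jointly measurable in time and path (at fixed \<open>k\<close> it is a
  countable case distinction on the integer part) and agrees with evaluation at continuous paths.
\<close>

definition dyadic_eval :: "real \<Rightarrow> (real \<Rightarrow> real) \<Rightarrow> real" where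
  "dyadic_eval s w = lim (\<lambda>k. w (real (nat \<lfloor>2 ^ k * s\<rfloor>) / 2 ^ k))"

lemma dyadic_floor_tendsto:
  assumes "0 \<le> s"
  shows "(\<lambda>k. real (nat \<lfloor>2 ^ k * s\<rfloor>) / 2 ^ k) \<longlonglongrightarrow> s"
proof (rule tendsto_sandwich)
  have b: "s - (1/2)^k \<le> real (nat \<lfloor>2 ^ k * s\<rfloor>) / 2 ^ k \<and> real (nat \<lfloor>2 ^ k * s\<rfloor>) / 2 ^ k \<le> s" for k
  proof -
    have "real (nat \<lfloor>2 ^ k * s\<rfloor>) = of_int \<lfloor>2 ^ k * s\<rfloor>" using assms by simp
    then have "2 ^ k * s - 1 \<le> real (nat \<lfloor>2 ^ k * s\<rfloor>)" "real (nat \<lfloor>2 ^ k * s\<rfloor>) \<le> 2 ^ k * s" by linarith+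
    then have "(2 ^ k * s - 1) / 2 ^ k \<le> real (nat \<lfloor>2 ^ k * s\<rfloor>) / 2 ^ k"
      "real (nat \<lfloor>2 ^ k * s\<rfloor>) / 2 ^ k \<le> (2 ^ k * s) / 2 ^ k" by (intro divide_right_mono; simp)+
    then show ?thesis by (simp add: diff_divide_distrib power_divide)
  qed
  show "\<forall>\<^sub>F k in sequentially. s - (1/2)^k \<le> real (nat \<lfloor>2 ^ k * s\<rfloor>) / 2 ^ k" using b by simp
  show "\<forall>\<^sub>F k in sequentially. real (nat \<lfloor>2 ^ k * s\<rfloor>) / 2 ^ k \<le> s" using b by simp
  have "(\<lambda>k. s - (1/2)^k) \<longlonglongrightarrow> s - 0" by (intro tendsto_intros LIMSEQ_power_zero) simp
  then show "(\<lambda>k. s - (1/2)^k) \<longlonglongrightarrow> s" by simp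
qed simp

lemma dyadic_eval_path_of:
  assumes "continuous_on {0..} (\<lambda>t. W t \<omega>)" "0 \<le> s"
  shows "dyadic_eval s (path_of W \<omega>) = W s \<omega>"
proof -
  have "(\<lambda>k. W (real (nat \<lfloor>2 ^ k * s\<rfloor>) / 2 ^ k) \<omega>) \<longlonglongrightarrow> W s \<omega>"
    by (rule continuous_on_tendsto_compose[OF assms(1) dyadic_floor_tendsto]) (use assms in auto)
  then show ?thesis
    by (auto simp: dyadic_eval_def path_of_def intro: limI)
qed

lemma dyadic_eval_pair_measurable:
  "(\<lambda>x. dyadic_eval (fst x) (snd x)) \<in> borel_measurable (borel \<Otimes>\<^sub>M path_space)"
  unfolding dyadic_eval_def
proof (rule borel_measurable_lim_metric)
  fix k :: nat
  show "(\<lambda>x. snd x (real (nat \<lfloor>2 ^ k * fst x :: real\<rfloor>) / 2 ^ k)) \<in> borel_measurable (borel \<Otimes>\<^sub>M path_space)"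
  proof (rule measurable_compose_countable[where f="\<lambda>j x. snd x (real j / 2 ^ k)"])
    show "(\<lambda>x. snd x (real j / 2 ^ k)) \<in> borel_measurable (borel \<Otimes>\<^sub>M path_space)" for j
      by (intro measurable_compose[OF measurable_snd] measurable_component_singleton) auto
    show "(\<lambda>x. nat \<lfloor>2 ^ k * fst x :: real\<rfloor>) \<in> borel \<Otimes>\<^sub>M path_space \<rightarrow>\<^sub>M count_space UNIV"
      by measurable
  qed
qed

lemma dyadic_eval_measurable [measurable (raw)]:
  assumes "f \<in> borel_measurable M" "g \<in> M \<rightarrow>\<^sub>M path_space"
  shows "(\<lambda>x. dyadic_eval (f x) (g x)) \<in> borel_measurable M"
  using measurable_compose[OF measurable_Pair[OF assms] dyadic_eval_pair_measurable] by simp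

lemma additive_functional_dyadic_eval_measurable [measurable]:
  assumes [measurable]: "k \<in> borel_measurable borel"
  shows "additive_functional k dyadic_eval u \<in> borel_measurable path_space"
proof -
  have "(\<lambda>w. LINT s|lborel. indicator {0..u} s *\<^sub>R k (dyadic_eval s w)) \<in> borel_measurable path_space"
    by measurable
  then show ?thesis by (simp add: additive_functional_def[abs_def] set_lebesgue_integral_def)
qed

text \<open>
  The three definitions of additive functional, right inverse and time change see a path only at times
  \<open>s \<ge> 0\<close>; therefore they can be computed from its image in the path space.
\<close>

lemma additive_functional_path_of:
  assumes "continuous_on {0..} (\<lambda>t. W t \<omega>)"
  shows "additive_functional k dyadic_eval u (path_of W \<omega>) = additive_functional k W u \<omega>"
  unfolding additive_functional_def
  by (rule set_lebesgue_integral_cong) (auto simp: dyadic_eval_path_of[of W, OF assms])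

lemma right_inverse_time_nonneg: "0 \<le> right_inverse_time S t \<omega>"
  unfolding right_inverse_time_def by (auto intro!: Inf_greatest)

lemma time_changed_path_of:
  assumes "continuous_on {0..} (\<lambda>t. W t \<omega>)"
  shows "time_changed g dyadic_eval t (path_of W \<omega>) = time_changed g W t \<omega>"
proof -
  have "right_inverse_time (additive_functional (\<lambda>x. 1 / g x) dyadic_eval) t (path_of W \<omega>)
      = right_inverse_time (additive_functional (\<lambda>x. 1 / g x) W) t \<omega>"
    by (simp add: right_inverse_time_def additive_functional_path_of[of W, OF assms])
  then show ?thesis
    by (simp add: time_changed_def dyadic_eval_path_of[of W, OF assms] real_of_ereal_pos right_inverse_time_nonneg)
qed

lemma additive_functional_mono:
  assumes k: "\<And>x. 0 \<le> k x" "\<And>x. k x \<le> C" and m: "(\<lambda>s. k (W s \<omega>)) \<in> borel_measurable borel" and u: "u \<le> v"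
  shows "additive_functional k W u \<omega> \<le> additive_functional k W v \<omega>"
proof -
  have int: "set_integrable lborel {0..a} (\<lambda>s. k (W s \<omega>))" for a
  proof (rule set_integrable_bound)
    show "set_integrable lborel {0..a} (\<lambda>_. C)"
      by (auto simp: set_integrable_def emeasure_lborel_Icc_eq)
    show "AE s in lborel. s \<in> {0..a} \<longrightarrow> norm (k (W s \<omega>)) \<le> norm C"
      using k by (auto simp: abs_of_nonneg intro!: order_trans[OF _ abs_ge_self])
  qed (use m in \<open>simp add: set_borel_measurable_def\<close>)
  show ?thesis
    unfolding additive_functional_def set_lebesgue_integral_def
    by (rule integral_mono) (use int u k in \<open>auto simp: set_integrable_def indicator_def\<close>)
qed

text \<open>
  For a monotone clock the infimum may be taken over rational times, hence over countably many
  measurable functions.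
\<close>

lemma right_inverse_time_measurable:
  assumes S: "\<And>u. S u \<in> borel_measurable M" and mono: "\<And>\<omega> u v. \<omega> \<in> space M \<Longrightarrow> u \<le> v \<Longrightarrow> S u \<omega> \<le> S v \<omega>"
  shows "right_inverse_time S t \<in> borel_measurable M"
proof -
  have eq: "right_inverse_time S t \<omega> = (INF q\<in>{q\<in>\<rat>. 0 < q}. if t < S q \<omega> then ereal q else \<infinity>)"
    if "\<omega> \<in> space M" for \<omega>
  proof (rule antisym)
    show "right_inverse_time S t \<omega> \<le> (INF q\<in>{q\<in>\<rat>. 0 < q}. if t < S q \<omega> then ereal q else \<infinity>)"
      unfolding right_inverse_time_def by (rule INF_greatest) (auto intro: Inf_lower)
    show "(INF q\<in>{q\<in>\<rat>. 0 < q}. if t < S q \<omega> then ereal q else \<infinity>) \<le> right_inverse_time S t \<omega>"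
      unfolding right_inverse_time_def
    proof (safe intro!: Inf_greatest)
      fix u assume u: "0 < u" "t < S u \<omega>"
      show "(INF q\<in>{q\<in>\<rat>. 0 < q}. if t < S q \<omega> then ereal q else \<infinity>) \<le> ereal u"
      proof (rule ereal_le_epsilon2[of _ "ereal u"])
        fix e :: real assume "0 < e"
        then obtain q where q: "q \<in> \<rat>" "u < q" "q < u + e" using Rats_dense_in_real[of u "u + e"] by auto
        with u mono[OF that, of u q] have "t < S q \<omega>" "0 < q" by auto
        with q have "(INF q\<in>{q\<in>\<rat>. 0 < q}. if t < S q \<omega> then ereal q else \<infinity>) \<le> ereal q"
          by (intro INF_lower2[of q]) auto
        also have "\<dots> \<le> ereal u + ereal e" using q by simp
        finally show "(INF q\<in>{q\<in>\<rat>. 0 < q}. if t < S q \<omega> then ereal q else \<infinity>) \<le> ereal u + ereal e" .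
      qed
    qed
  qed
  have [measurable]: "Measurable.pred M (\<lambda>\<omega>. t < S q \<omega>)" for q using S[of q] by measurable
  have "countable {q\<in>\<rat>. 0 < (q::real)}" by (rule countable_subset[OF _ countable_rat]) auto
  then have "(\<lambda>\<omega>. INF q\<in>{q\<in>\<rat>. 0 < q}. if t < S q \<omega> then ereal q else \<infinity>) \<in> borel_measurable M"
    by (intro borel_measurable_INF) measurable
  then show ?thesis by (subst measurable_cong[OF eq])
qed

text \<open>
  The clock is measurable as a parametric integral, its right inverse by monotonicity, and the time change
  by the joint measurability of \<open>dyadic_eval\<close>.
\<close>

lemma time_changed_dyadic_eval_measurable:
  assumes g [measurable]: "(\<lambda>x. 1 / g x) \<in> borel_measurable borel" and b: "\<And>x. 0 \<le> 1 / g x" "\<And>x. 1 / g x \<le> C"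
  shows "time_changed g dyadic_eval t \<in> borel_measurable path_space"
proof -
  have [measurable]: "right_inverse_time (additive_functional (\<lambda>x. 1 / g x) dyadic_eval) t \<in> borel_measurable path_space"
  proof (rule right_inverse_time_measurable)
    show "additive_functional (\<lambda>x. 1 / g x) dyadic_eval u w \<le> additive_functional (\<lambda>x. 1 / g x) dyadic_eval v w"
      if "w \<in> space path_space" "u \<le> v" for w u v
      by (rule additive_functional_mono[OF b _ that(2)]) (use that(1) in measurable)
  qed measurable
  show ?thesis unfolding time_changed_def[abs_def] by measurable
qed

text \<open>
  Fubini: at each fixed \<open>s > 0\<close> the value is almost surely nonzero because it has a density.
  The argument is carried out for \<open>dyadic_eval\<close>, which is jointly measurable.
\<close>

lemma wiener_ae_nonzero:
  assumes W: "standard_wiener M W"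
  shows "AE \<omega> in M. AE s in lborel. 0 < s \<longrightarrow> W s \<omega> \<noteq> 0"
proof -
  interpret prob_space M using standard_wiener_prob_space[OF W] .
  interpret pair_sigma_finite lborel M ..
  note [measurable] = path_of_measurable[OF W]
  have "AE \<omega> in M. W s \<omega> \<noteq> 0" if s: "0 < s" for s
  proof -
    have [measurable]: "W s \<in> borel_measurable M" "W 0 \<in> borel_measurable M"
      using standard_wiener_measurable[OF W] s by auto
    have "emeasure M ((\<lambda>\<omega>. W s \<omega> - W 0 \<omega>) -` {0} \<inter> space M)
        = (\<integral>\<^sup>+x. ennreal (normal_density 0 (sqrt (s - 0)) x) * indicator {0} x \<partial>lborel)"
      by (rule distributed_emeasure[OF standard_wiener_increment[OF W _ s]]) auto
    also have "\<dots> = 0" by (rule nn_integral_null_set) (simp add: null_sets_def)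
    finally have "(\<lambda>\<omega>. W s \<omega> - W 0 \<omega>) -` {0} \<inter> space M \<in> null_sets M"
      by (auto simp: null_sets_def)
    from AE_not_in[OF this] standard_wiener_start[OF W] AE_space[of M]
    show ?thesis
    proof eventually_elim
      case (elim \<omega>)
      then show ?case by simp
    qed
  qed
  note nz = this
  have "AE \<omega> in M. 0 < s \<longrightarrow> dyadic_eval s (path_of W \<omega>) \<noteq> 0" for s
  proof (cases "0 < s")
    case True
    from nz[OF True] standard_wiener_continuous[OF W] show ?thesis
    proof eventually_elim
      case (elim \<omega>)
      then show ?case using True by (simp add: dyadic_eval_path_of[where W=W and \<omega>=\<omega>])
    qed
  qed simp
  then have "AE s in lborel. AE \<omega> in M. 0 < s \<longrightarrow> dyadic_eval s (path_of W \<omega>) \<noteq> 0" by simp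
  also have "?this \<longleftrightarrow> (AE \<omega> in M. AE s in lborel. 0 < s \<longrightarrow> dyadic_eval s (path_of W \<omega>) \<noteq> 0)"
    by (rule AE_commute) measurable
  finally show ?thesis
    using standard_wiener_continuous[OF W]
  proof eventually_elim
    case (elim \<omega>)
    from elim(1) show ?case by eventually_elim (auto simp: dyadic_eval_path_of[where W=W and \<omega>=\<omega>, OF elim(2)])
  qed
qed


section \<open>Clocks and their inverses\<close>

text \<open>
  The conditions under which a function on \<open>{0..}\<close> is an increasing bijection onto \<open>{0..}\<close>.
\<close>

definition clock :: "(real \<Rightarrow> real) \<Rightarrow> bool" where
  "clock S \<longleftrightarrow> continuous_on {0..} S \<and> strict_mono_on {0..} S \<and> S 0 = 0 \<and> (\<forall>t. \<exists>u\<ge>0. t < S u)"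

definition clock_inv :: "(real \<Rightarrow> real) \<Rightarrow> real \<Rightarrow> real" where
  "clock_inv S = the_inv_into {0..} S"

lemma clock_less_iff: "clock S \<Longrightarrow> 0 \<le> u \<Longrightarrow> 0 \<le> v \<Longrightarrow> S u < S v \<longleftrightarrow> u < v"
  unfolding clock_def using strict_mono_on_less[of "{0..}" S u v] by simp

lemma clock_inv:
  assumes S: "clock S" and t: "0 \<le> t"
  shows "0 \<le> clock_inv S t" "S (clock_inv S t) = t"
proof -
  obtain v where v: "0 \<le> v" "t < S v" using S by (auto simp: clock_def)
  have "\<exists>u\<ge>0. u \<le> v \<and> S u = t"
    by (rule IVT') (use S v t in \<open>auto simp: clock_def intro: continuous_on_subset\<close>)
  then have "t \<in> S ` {0..}" by auto
  moreover have "inj_on S {0..}" using S by (auto simp: clock_def intro: strict_mono_on_imp_inj_on)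
  ultimately show "0 \<le> clock_inv S t" "S (clock_inv S t) = t"
    using the_inv_into_into[of S "{0..}" t "{0..}"] f_the_inv_into_f[of S "{0..}" t]
    by (auto simp: clock_inv_def)
qed

text \<open>
  If \<open>S\<close> takes the value \<open>t\<close> at \<open>\<tau>\<close>, the times at which it exceeds \<open>t\<close> form the open ray to the right
  of \<open>\<tau>\<close>.
\<close>

lemma right_inverse_time_clock:
  assumes S: "clock (\<lambda>u. S u \<omega>)" and t: "0 \<le> t"
  shows "right_inverse_time S t \<omega> = ereal (clock_inv (\<lambda>u. S u \<omega>) t)"
proof -
  let ?T = "clock_inv (\<lambda>u. S u \<omega>) t"
  have T: "0 \<le> ?T" "S ?T \<omega> = t" using clock_inv[OF S t] by auto
  have "{u. u > 0 \<and> S u \<omega> > t} = {?T<..}"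
    using clock_less_iff[OF S, of ?T] T by fastforce
  moreover have "Inf (ereal ` {a<..}) = ereal a" for a
  proof (rule antisym)
    show "Inf (ereal ` {a<..}) \<le> ereal a"
    proof (rule ereal_le_epsilon2)
      fix e :: real assume "0 < e"
      then show "Inf (ereal ` {a<..}) \<le> ereal a + ereal e" by (auto intro: Inf_lower)
    qed
  qed (auto intro: Inf_greatest)
  ultimately show ?thesis by (simp add: right_inverse_time_def)
qed

text \<open>
  If \<open>a\<close> lies below the limiting inverse time then \<open>S' a < t\<close>, so eventually \<open>S n a < x n\<close>, which says that
  \<open>a\<close> lies below the inverse time of \<open>S n\<close>; likewise from above.  The times \<open>x n\<close> may vary, which is
  what yields uniformity on compact intervals.
\<close>

lemma clock_inv_tendsto:
  fixes S :: "nat \<Rightarrow> real \<Rightarrow> real"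
  assumes S: "\<And>n. clock (S n)" and S': "clock S'" and conv: "\<And>u. 0 \<le> u \<Longrightarrow> (\<lambda>n. S n u) \<longlonglongrightarrow> S' u"
    and x: "x \<longlonglongrightarrow> t" "\<And>n. 0 \<le> x n" "0 \<le> t"
  shows "(\<lambda>n. clock_inv (S n) (x n)) \<longlonglongrightarrow> clock_inv S' t"
proof (rule order_tendstoI)
  note T = clock_inv[OF S x(2)] and T' = clock_inv[OF S' x(3)]
  fix a assume a: "a < clock_inv S' t"
  show "\<forall>\<^sub>F n in sequentially. a < clock_inv (S n) (x n)"
  proof (cases "a < 0")
    case True
    then show ?thesis using T(1) by (auto intro!: always_eventually order_less_le_trans[of a 0])
  next
    case False
    then have "S' a < t" using clock_less_iff[OF S', of a "clock_inv S' t"] a T' by auto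
    then obtain m where m: "S' a < m" "m < t" using dense by blast
    from order_tendstoD(2)[OF conv m(1)] order_tendstoD(1)[OF x(1) m(2)] False
    have "\<forall>\<^sub>F n in sequentially. S n a < m" "\<forall>\<^sub>F n in sequentially. m < x n" by auto
    then show ?thesis
    proof eventually_elim
      case (elim n)
      then have "S n a < S n (clock_inv (S n) (x n))" using T(2)[of n] by simp
      then show ?case using clock_less_iff[OF S, of a "clock_inv (S n) (x n)"] False T(1)[of n] by auto
    qed
  qed
next
  note T = clock_inv[OF S x(2)] and T' = clock_inv[OF S' x(3)]
  fix a assume a: "clock_inv S' t < a"
  then have a0: "0 \<le> a" using T'(1) by simp
  then have "t < S' a" using clock_less_iff[OF S', of "clock_inv S' t" a] a T' by auto
  then obtain m where m: "t < m" "m < S' a" using dense by blast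
  from order_tendstoD(1)[OF conv[OF a0] m(2)] order_tendstoD(2)[OF x(1) m(1)]
  show "\<forall>\<^sub>F n in sequentially. clock_inv (S n) (x n) < a"
  proof eventually_elim
    case (elim n)
    then have "S n (clock_inv (S n) (x n)) < S n a" using T(2)[of n] by simp
    then show ?case using clock_less_iff[OF S, of "clock_inv (S n) (x n)" a] a0 T(1)[of n] by auto
  qed
qed

text \<open>
  The preceding lemma for a constant sequence of clocks.
\<close>

lemma clock_inv_continuous:
  assumes "clock S"
  shows "continuous_on {0..} (clock_inv S)"
  unfolding continuous_on_sequentially comp_def
  using assms by (auto intro!: clock_inv_tendsto)

text \<open>
  If uniform convergence failed, there would be \<open>e > 0\<close> and points of \<open>K\<close>, for infinitely many \<open>n\<close>, where \<open>f n\<close> is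
  at least \<open>e\<close> away from \<open>l\<close>; an accumulation point of them contradicts the hypothesis.  The
  subsequence \<open>r\<close> in the hypothesis allows these points to be used as they come, without filling the gaps.
\<close>

lemma uniform_limit_of_continuous_convergence:
  fixes f :: "nat \<Rightarrow> 'a::metric_space \<Rightarrow> 'b::metric_space"
  assumes K: "compact K" and l: "continuous_on K l"
    and conv: "\<And>r x a. strict_mono r \<Longrightarrow> (\<And>n. x n \<in> K) \<Longrightarrow> a \<in> K \<Longrightarrow> x \<longlonglongrightarrow> a \<Longrightarrow> (\<lambda>n. f (r n) (x n)) \<longlonglongrightarrow> l a"
  shows "uniform_limit K f l sequentially"
proof (rule ccontr)
  assume "\<not> uniform_limit K f l sequentially"
  then obtain e where e: "0 < e" "\<exists>\<^sub>F n in sequentially. \<exists>x\<in>K. e \<le> dist (f n x) (l x)"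
    by (auto simp: uniform_limit_iff not_eventually not_less)
  then have "infinite {n. \<exists>x\<in>K. e \<le> dist (f n x) (l x)}"
    by (simp add: frequently_sequentially infinite_nat_iff_unbounded_le)
  from infinite_enumerate[OF this]
  obtain r :: "nat \<Rightarrow> nat" where r: "strict_mono r" "\<And>n. \<exists>x\<in>K. e \<le> dist (f (r n) x) (l x)"
    by blast
  from r(2) have "\<forall>n. \<exists>x. x \<in> K \<and> e \<le> dist (f (r n) x) (l x)" by blast
  from choice[OF this] obtain x where x: "\<And>n. x n \<in> K" "\<And>n. e \<le> dist (f (r n) (x n)) (l (x n))" by blast
  obtain a q where q: "a \<in> K" "strict_mono q" "(x \<circ> q) \<longlonglongrightarrow> a"
    using seq_compactE[OF K[unfolded compact_eq_seq_compact_metric], of x] x(1) by auto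
  have "(\<lambda>n. f (r (q n)) (x (q n))) \<longlonglongrightarrow> l a"
    using conv[OF strict_mono_o[OF r(1) q(2)], of "x \<circ> q" a] q x(1) by (simp add: comp_def)
  moreover have "(\<lambda>n. l (x (q n))) \<longlonglongrightarrow> l a"
    using l q x(1) by (auto simp: continuous_on_sequentially comp_def)
  ultimately have "(\<lambda>n. dist (f (r (q n)) (x (q n))) (l (x (q n)))) \<longlonglongrightarrow> dist (l a) (l a)"
    by (rule tendsto_dist)
  then have "e \<le> dist (l a) (l a)"
    using x(2) by (intro LIMSEQ_le_const) auto
  with e(1) show False by simp
qed

text \<open>
  A path is controlled at nonnegative times only.  Extending it by its value at \<open>0\<close> makes it continuous on the
  whole line, and changes no integral over \<open>{0..u}\<close>.
\<close>

lemma continuous_stopped_measurable: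
  assumes "continuous_on {0..} (\<lambda>s. W s \<omega>)"
  shows "(\<lambda>s::real. W (max 0 s) \<omega> :: real) \<in> borel_measurable borel"
  by (intro borel_measurable_continuous_onI continuous_on_compose2[OF assms]) (auto intro!: continuous_intros)

lemma additive_functional_increment:
  assumes k: "k \<in> borel_measurable borel" "\<And>x. 0 \<le> k x" "\<And>x. k x \<le> C"
    and W: "continuous_on {0..} (\<lambda>s. W s \<omega>)" and u: "0 \<le> u" "u \<le> v"
  shows "set_integrable lborel {u<..v} (\<lambda>s. k (W s \<omega>))"
    and "additive_functional k W v \<omega> - additive_functional k W u \<omega> = (LINT s:{u<..v}|lborel. k (W s \<omega>))"
proof -
  have int: "set_integrable lborel A (\<lambda>s. k (W s \<omega>))"
    if A: "A \<in> sets borel" "emeasure lborel A < \<infinity>" "A \<subseteq> {0..}" for A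
  proof (rule set_integrable_bound)
    show "set_integrable lborel A (\<lambda>_. C)" using A by (auto simp: set_integrable_def)
    show "AE s in lborel. s \<in> A \<longrightarrow> norm (k (W s \<omega>)) \<le> norm C"
      using k by (auto simp: abs_of_nonneg intro!: order_trans[OF _ abs_ge_self])
    have "(\<lambda>s. indicator A s *\<^sub>R k (W (max 0 s) \<omega>)) \<in> borel_measurable lborel"
      using A(1) measurable_compose[OF continuous_stopped_measurable[where W=W and \<omega>=\<omega>, OF W] k(1)] by measurable
    also have "(\<lambda>s. indicator A s *\<^sub>R k (W (max 0 s) \<omega>)) = (\<lambda>s. indicator A s *\<^sub>R k (W s \<omega>))"
      using A(3) by (auto simp: fun_eq_iff indicator_def)
    finally show "set_borel_measurable lborel A (\<lambda>s. k (W s \<omega>))" by (simp add: set_borel_measurable_def)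
  qed
  show i: "set_integrable lborel {u<..v} (\<lambda>s. k (W s \<omega>))" by (rule int) (use u in auto)
  have j: "set_integrable lborel {0..u} (\<lambda>s. k (W s \<omega>))" by (rule int) (auto simp: emeasure_lborel_Icc_eq)
  have "{0..v} = {0..u} \<union> {u<..v}" using u by auto
  then have "additive_functional k W v \<omega> = additive_functional k W u \<omega> + (LINT s:{u<..v}|lborel. k (W s \<omega>))"
    unfolding additive_functional_def by (simp only:) (rule set_integral_Un[OF _ j i], auto)
  then show "additive_functional k W v \<omega> - additive_functional k W u \<omega> = (LINT s:{u<..v}|lborel. k (W s \<omega>))" by simp
qed

lemma additive_functional_lipschitz:
  assumes k: "k \<in> borel_measurable borel" "\<And>x. 0 \<le> k x" "\<And>x. k x \<le> C"
    and W: "continuous_on {0..} (\<lambda>s. W s \<omega>)" and u: "0 \<le> u" "u \<le> v"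
  shows "0 \<le> additive_functional k W v \<omega> - additive_functional k W u \<omega>"
    and "additive_functional k W v \<omega> - additive_functional k W u \<omega> \<le> C * (v - u)"
proof -
  note inc = additive_functional_increment[where W=W and \<omega>=\<omega>, OF assms]
  show "0 \<le> additive_functional k W v \<omega> - additive_functional k W u \<omega>"
    unfolding inc(2) set_lebesgue_integral_def using k(2) by (intro integral_nonneg_AE) auto
  have "(LINT s:{u<..v}|lborel. k (W s \<omega>)) \<le> (LINT s:{u<..v}|lborel. C)"
    by (rule set_integral_mono) (use inc(1) u k in \<open>auto simp: set_integrable_def\<close>)
  also have "\<dots> = C * (v - u)" using u by (simp add: set_lebesgue_integral_def)
  finally show "additive_functional k W v \<omega> - additive_functional k W u \<omega> \<le> C * (v - u)" unfolding inc(2) .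
qed

lemma additive_functional_continuous:
  assumes k: "k \<in> borel_measurable borel" "\<And>x. 0 \<le> k x" "\<And>x. k x \<le> C"
    and W: "continuous_on {0..} (\<lambda>s. W s \<omega>)"
  shows "continuous_on {0..} (\<lambda>u. additive_functional k W u \<omega>)"
proof (rule lipschitz_on_continuous_on)
  have C: "0 \<le> C" using k(2,3)[of 0] by linarith
  show "C-lipschitz_on {0..} (\<lambda>u. additive_functional k W u \<omega>)"
  proof (rule lipschitz_onI[OF _ C])
    fix u v :: real assume "u \<in> {0..}" "v \<in> {0..}"
    then show "dist (additive_functional k W u \<omega>) (additive_functional k W v \<omega>) \<le> C * dist u v"
      using additive_functional_lipschitz[where W=W and \<omega>=\<omega>, OF k W, of u v] additive_functional_lipschitz[where W=W and \<omega>=\<omega>, OF k W, of v u]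
      by (cases "u \<le> v") (auto simp: dist_real_def abs_real_def)
  qed
qed

text \<open>
  If the increment over \<open>{u<..v}\<close> vanished, a positive integrand would vanish almost everywhere on a set of
  positive measure.
\<close>

lemma additive_functional_strict_mono:
  assumes k: "k \<in> borel_measurable borel" "\<And>x. 0 \<le> k x" "\<And>x. k x \<le> C"
    and W: "continuous_on {0..} (\<lambda>s. W s \<omega>)" and pos: "AE s in lborel. 0 < s \<longrightarrow> 0 < k (W s \<omega>)"
  shows "strict_mono_on {0..} (\<lambda>u. additive_functional k W u \<omega>)"
proof (rule strict_mono_onI)
  fix u v :: real assume uv: "u \<in> {0..}" "v \<in> {0..}" "u < v"
  then have u: "0 \<le> u" "u \<le> v" by auto
  note inc = additive_functional_increment[where W=W and \<omega>=\<omega>, OF k W u]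
  have "additive_functional k W v \<omega> - additive_functional k W u \<omega> \<noteq> 0"
  proof
    assume "additive_functional k W v \<omega> - additive_functional k W u \<omega> = 0"
    then have "(LINT s|lborel. indicator {u<..v} s *\<^sub>R k (W s \<omega>)) = 0"
      unfolding inc(2) set_lebesgue_integral_def .
    then have "AE s in lborel. indicator {u<..v} s *\<^sub>R k (W s \<omega>) = 0"
      by (subst (asm) integral_nonneg_eq_0_iff_AE) (use inc(1) k in \<open>auto simp: set_integrable_def\<close>)
    with pos have "AE s in lborel. s \<notin> {u<..v}"
      by eventually_elim (use u in \<open>auto simp: indicator_def split: if_splits\<close>)
    then have "emeasure lborel {u<..v} = 0" by (subst (asm) AE_iff_measurable[of "{u<..v}"]) auto
    then show False using uv by simp
  qed
  with additive_functional_lipschitz(1)[where W=W and \<omega>=\<omega>, OF k W u]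
  show "additive_functional k W u \<omega> < additive_functional k W v \<omega>" by simp
qed

lemma additive_functional_clock:
  assumes k: "k \<in> borel_measurable borel" "\<And>x. 0 \<le> k x" "\<And>x. k x \<le> C"
    and W: "continuous_on {0..} (\<lambda>s. W s \<omega>)" and pos: "AE s in lborel. 0 < s \<longrightarrow> 0 < k (W s \<omega>)"
    and unb: "\<And>t. \<exists>u\<ge>0. t < additive_functional k W u \<omega>"
  shows "clock (\<lambda>u. additive_functional k W u \<omega>)"
proof -
  have "(LINT s:{0..0}|lborel. k (W s \<omega>)) = 0"
    unfolding set_lebesgue_integral_def
    by (rule integral_eq_zero_AE) (use AE_lborel_singleton[of 0] in \<open>auto elim: eventually_mono\<close>)
  then show ?thesis
    using additive_functional_continuous[where W=W and \<omega>=\<omega>, OF k W] additive_functional_strict_mono[where W=W and \<omega>=\<omega>, OF k W pos] unb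
    by (auto simp: clock_def additive_functional_def)
qed

text \<open>
  Dominated convergence with the constant \<open>C\<close> as bound.  Convergence of the rates off \<open>0\<close> suffices,
  since the path is at \<open>0\<close> only during a null set of times.
\<close>

lemma additive_functional_tendsto:
  fixes k :: "nat \<Rightarrow> real \<Rightarrow> real"
  assumes k: "\<And>n. k n \<in> borel_measurable borel" "\<And>n x. 0 \<le> k n x" "\<And>n x. k n x \<le> C"
    and l: "l \<in> borel_measurable borel" and conv: "\<And>x. x \<noteq> 0 \<Longrightarrow> (\<lambda>n. k n x) \<longlonglongrightarrow> l x"
    and W: "continuous_on {0..} (\<lambda>s. W s \<omega>)" and nz: "AE s in lborel. 0 < s \<longrightarrow> W s \<omega> \<noteq> 0"
  shows "(\<lambda>n. additive_functional (k n) W u \<omega>) \<longlonglongrightarrow> additive_functional l W u \<omega>"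
proof -
  have *: "additive_functional k W u \<omega> = (LINT s|lborel. indicator {0..u} s *\<^sub>R k (W (max 0 s) \<omega>))" for k :: "real \<Rightarrow> real"
    unfolding additive_functional_def set_lebesgue_integral_def
    by (rule Bochner_Integration.integral_cong) (auto simp: indicator_def)
  note [measurable] = continuous_stopped_measurable[where W=W and \<omega>=\<omega>, OF W] k(1) l
  show ?thesis unfolding *
  proof (rule integral_dominated_convergence[where w="\<lambda>s. indicator {0..u} s *\<^sub>R C"])
    show "integrable lborel (\<lambda>s. indicator {0..u} s *\<^sub>R C)" by (auto simp: emeasure_lborel_Icc_eq)
    show "AE s in lborel. (\<lambda>n. indicator {0..u} s *\<^sub>R k n (W (max 0 s) \<omega>)) \<longlonglongrightarrow> indicator {0..u} s *\<^sub>R l (W (max 0 s) \<omega>)"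
      using nz AE_lborel_singleton[of "0::real"]
    proof eventually_elim
      case (elim s)
      then show ?case by (cases "s \<in> {0..u}") (auto intro!: conv)
    qed
    show "AE s in lborel. norm (indicator {0..u} s *\<^sub>R k n (W (max 0 s) \<omega>)) \<le> indicator {0..u} s *\<^sub>R C" for n
      using k(2,3) by (auto simp: indicator_def)
  qed measurable
qed


section \<open>Random elements of the space of continuous functions\<close>

lemma mspace_C_metric: "mspace (C_metric T) = {f. f \<in> extensional {0..T} \<and> continuous_on {0..T} f}"
proof -
  have "compactin (top_of_set {0..T}) (topspace (top_of_set {0..T}))"
    by (simp add: compactin_subtopology)
  from compactin_mspace_cfunspace[OF this, of "euclidean_metric :: real metric"]
  show ?thesis by (auto simp: C_metric_def)
qed

lemma restrict_in_C_metric: "continuous_on {0..T} z \<Longrightarrow> restrict z {0..T} \<in> mspace (C_metric T)"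
  unfolding mspace_C_metric mem_Collect_eq
  by (intro conjI restrict_extensional, rule continuous_on_eq) auto

lemma mdist_C_metric_le:
  "0 \<le> a \<Longrightarrow> (\<And>x. x \<in> {0..T} \<Longrightarrow> dist (f x) (g x) \<le> a) \<Longrightarrow> mdist (C_metric T) f g \<le> a"
  unfolding C_metric_def by (rule mdist_cfunspace_le) auto

lemma limitin_C_metric:
  assumes "\<And>n. f n \<in> mspace (C_metric T)" "continuous_on {0..T} g" "uniform_limit {0..T} f g F"
  shows "limitin (mtopology_of (C_metric T)) f (restrict g {0..T}) F"
proof -
  interpret C: Metric_space "mspace (C_metric T)" "mdist (C_metric T)"
    by (rule Metric_space_mspace_mdist)
  show ?thesis
    unfolding mtopology_of_def C.limitin_metric
  proof (intro conjI allI impI)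
    fix e :: real assume "0 < e"
    then have "\<forall>\<^sub>F n in F. \<forall>x\<in>{0..T}. dist (f n x) (g x) < e / 2"
      using uniform_limitD[OF assms(3), of "e / 2"] by simp
    then show "\<forall>\<^sub>F n in F. f n \<in> mspace (C_metric T) \<and> mdist (C_metric T) (f n) (restrict g {0..T}) < e"
    proof eventually_elim
      case (elim n)
      then have "mdist (C_metric T) (f n) (restrict g {0..T}) \<le> e / 2"
        using \<open>0 < e\<close> by (intro mdist_C_metric_le) (auto intro: less_imp_le)
      with \<open>0 < e\<close> assms(1) show ?case by auto
    qed
  qed (rule restrict_in_C_metric[OF assms(2)])
qed

text \<open>
  The rounded coefficients of the Bernstein polynomial of \<open>z\<close>, rescaled to \<open>{0..T}\<close>, in units of \<open>1 / m\<close>.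
  Rounding makes the set of values countable, so that every function of a sample is measurable.
\<close>

definition sample :: "real \<Rightarrow> nat \<Rightarrow> (real \<Rightarrow> real) \<Rightarrow> int list" where
  "sample T m z = map (\<lambda>k. \<lfloor>real m * z (T * (real k / real m))\<rfloor>) [0..<Suc m]"

definition bernstein_path :: "real \<Rightarrow> nat \<Rightarrow> int list \<Rightarrow> real \<Rightarrow> real" where
  "bernstein_path T m c = (\<lambda>x\<in>{0..T}. \<Sum>k\<le>m. real_of_int (c ! k) / real m * Bernstein m k (x / T))"

lemma bernstein_path_in_C_metric: "bernstein_path T m c \<in> mspace (C_metric T)"
  unfolding bernstein_path_def Bernstein_def divide_inverse
  by (intro restrict_in_C_metric continuous_on_sum continuous_on_mult continuous_on_power
      continuous_on_diff continuous_on_const continuous_on_id)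

text \<open>
  Bernstein polynomials of \<open>z\<close> converge uniformly.  Rounding changes each coefficient by at most \<open>1 / m\<close>, and
  the Bernstein basis is a partition of unity, so the rounded polynomial is within \<open>1 / m\<close> of
  the exact one.
\<close>

lemma bernstein_path_uniform_limit:
  assumes T: "0 < T" and z: "continuous_on {0..T} z"
  shows "uniform_limit {0..T} (\<lambda>m. bernstein_path T m (sample T m z)) z sequentially"
proof (rule uniform_limitI)
  fix e :: real assume e: "0 < e"
  have "continuous_on {0..1} (\<lambda>x. z (T * x))"
    by (rule continuous_on_compose2[OF z]) (use T in \<open>auto intro!: continuous_intros mult_left_le\<close>)
  from Bernstein_Weierstrass[OF this, of "e / 2"] e obtain N where
    N: "\<And>m x. N \<le> m \<Longrightarrow> x \<in> {0..1} \<Longrightarrow> \<bar>z (T * x) - (\<Sum>k\<le>m. z (T * (k / m)) * Bernstein m k x)\<bar> < e / 2" by auto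
  \<comment> \<open>Beyond \<open>N'\<close> the rounding error \<open>1 / m\<close> is below \<open>e / 2\<close>.\<close>
  obtain N' :: nat where N': "2 / e < N'" using reals_Archimedean2 by blast
  show "\<forall>\<^sub>F m in sequentially. \<forall>x\<in>{0..T}. dist (bernstein_path T m (sample T m z) x) (z x) < e"
  proof (rule eventually_sequentiallyI[of "max N N'"], safe)
    fix m x assume m: "max N N' \<le> m" and x: "x \<in> {0..T}"
    then have m0: "2 / e < m" using N' by linarith
    then have mpos: "0 < m" using e by (metis divide_pos_pos less_trans of_nat_0_less_iff zero_less_numeral)
    have y: "x / T \<in> {0..1}" using x T by auto
    have nth: "sample T m z ! k = \<lfloor>real m * z (T * (real k / real m))\<rfloor>" if "k \<le> m" for k
      unfolding sample_def using that by (subst nth_map) (auto simp del: upt_Suc)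
    have "\<bar>(\<Sum>k\<le>m. z (T * (k / m)) * Bernstein m k (x / T)) - bernstein_path T m (sample T m z) x\<bar>
        = \<bar>\<Sum>k\<le>m. (z (T * (k / m)) - real_of_int (sample T m z ! k) / m) * Bernstein m k (x / T)\<bar>"
      using x by (simp add: bernstein_path_def sum_subtractf[symmetric] algebra_simps)
    also have "\<dots> \<le> (\<Sum>k\<le>m. \<bar>(z (T * (k / m)) - real_of_int (sample T m z ! k) / m) * Bernstein m k (x / T)\<bar>)"
      by (rule sum_abs)
    also have "\<dots> \<le> (\<Sum>k\<le>m. 1 / m * Bernstein m k (x / T))"
    proof (rule sum_mono)
      fix k assume "k \<in> {..m}"
      then have k: "sample T m z ! k = \<lfloor>real m * z (T * (real k / real m))\<rfloor>" by (simp add: nth)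
      have "\<bar>real m * z (T * (k / m)) - real_of_int (sample T m z ! k)\<bar> \<le> 1" unfolding k by linarith
      moreover have "z (T * (k / m)) - real_of_int (sample T m z ! k) / m
          = (real m * z (T * (k / m)) - real_of_int (sample T m z ! k)) / m"
        using mpos by (simp add: diff_divide_distrib)
      ultimately have "\<bar>z (T * (k / m)) - real_of_int (sample T m z ! k) / m\<bar> \<le> 1 / m"
        using mpos by (simp only: abs_divide abs_of_nat) (intro divide_right_mono, simp_all)
      moreover have "0 \<le> Bernstein m k (x / T)" using y by (intro Bernstein_nonneg) auto
      ultimately show "\<bar>(z (T * (k / m)) - real_of_int (sample T m z ! k) / m) * Bernstein m k (x / T)\<bar> \<le> 1 / m * Bernstein m k (x / T)"
        by (simp only: abs_mult abs_of_nonneg) (rule mult_right_mono)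
    qed
    also have "\<dots> = 1 / m" by (simp only: sum_distrib_left[symmetric] sum_Bernstein mult_1_right)
    also have "\<dots> < e / 2" using m0 mpos e by (simp add: field_simps)
    finally have 1: "\<bar>(\<Sum>k\<le>m. z (T * (k / m)) * Bernstein m k (x / T)) - bernstein_path T m (sample T m z) x\<bar> < e / 2" .
    have "\<bar>z (T * (x / T)) - (\<Sum>k\<le>m. z (T * (k / m)) * Bernstein m k (x / T))\<bar> < e / 2"
      using N[of m "x / T"] y m by simp
    then have "\<bar>z x - (\<Sum>k\<le>m. z (T * (k / m)) * Bernstein m k (x / T))\<bar> < e / 2" using T by simp
    with 1 show "dist (bernstein_path T m (sample T m z) x) (z x) < e" unfolding dist_real_def by linarith
  qed
qed

lemma sample_measurable:
  assumes T: "0 \<le> T" and Z: "\<And>t. t \<in> {0..T} \<Longrightarrow> Z t \<in> borel_measurable M"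
  shows "(\<lambda>\<omega>. sample T m (\<lambda>t. Z t \<omega>)) \<in> M \<rightarrow>\<^sub>M count_space UNIV"
proof -
  have mem: "T * (real k / real m) \<in> {0..T}" if "k < Suc m" for k
    using that T mult_left_le[of "real k / real m" T] by (auto simp: divide_le_eq_1)
  have "(\<lambda>\<omega>. sample T m (\<lambda>t. Z t \<omega>)) -` {c} \<inter> space M \<in> sets M" for c
  proof -
    have eq: "(\<lambda>\<omega>. sample T m (\<lambda>t. Z t \<omega>)) -` {c} \<inter> space M
      = {\<omega>\<in>space M. length c = Suc m \<and> (\<forall>k\<in>{..<Suc m}. \<lfloor>real m * Z (T * (real k / real m)) \<omega>\<rfloor> = c ! k)}"
      by (auto simp: sample_def list_eq_iff_nth_eq simp del: upt_Suc)
    have [measurable]: "(\<lambda>\<omega>. \<lfloor>real m * Z (T * (real k / real m)) \<omega>\<rfloor>) \<in> M \<rightarrow>\<^sub>M count_space UNIV" if "k \<in> {..<Suc m}" for k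
    proof -
      have [measurable]: "Z (T * (real k / real m)) \<in> borel_measurable M" using that by (intro Z mem) simp
      show ?thesis by measurable
    qed
    show ?thesis unfolding eq by measurable
  qed
  then show ?thesis
    by (subst measurable_count_space_eq_countable) auto
qed

lemma sample_cong:
  assumes "0 \<le> T" "\<And>t. t \<in> {0..T} \<Longrightarrow> z t = z' t"
  shows "sample T m z = sample T m z'"
proof -
  have "T * (real k / real m) \<in> {0..T}" if "k < Suc m" for k
    using that assms(1) mult_left_le[of "real k / real m" T] by (auto simp: divide_le_eq_1)
  then show ?thesis using assms(2) by (auto simp: sample_def simp del: upt_Suc)
qed

text \<open>
  Equal to \<open>F z\<close> for continuous \<open>z\<close> and continuous \<open>F\<close>, but defined as a limit of functions of
  samples, which makes it measurable in the values of \<open>z\<close> for arbitrary \<open>z\<close> and \<open>F\<close>.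
\<close>

definition sampled_value :: "real \<Rightarrow> ((real \<Rightarrow> real) \<Rightarrow> real) \<Rightarrow> (real \<Rightarrow> real) \<Rightarrow> real" where
  "sampled_value T F z = lim (\<lambda>m. F (bernstein_path T m (sample T m z)))"

lemma sampled_value_measurable:
  assumes "0 \<le> T" "\<And>t. t \<in> {0..T} \<Longrightarrow> Z t \<in> borel_measurable M"
  shows "(\<lambda>\<omega>. sampled_value T F (\<lambda>t. Z t \<omega>)) \<in> borel_measurable M"
  unfolding sampled_value_def
  by (intro borel_measurable_lim_metric measurable_compose[OF sample_measurable[OF assms]]) auto

lemma sampled_value_cong:
  "0 \<le> T \<Longrightarrow> (\<And>t. t \<in> {0..T} \<Longrightarrow> z t = z' t) \<Longrightarrow> sampled_value T F z = sampled_value T F z'"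
  using sample_cong[of T z z'] by (simp add: sampled_value_def)

lemma sampled_value_eq:
  assumes T: "0 < T" and z: "continuous_on {0..T} z"
    and F: "continuous_map (mtopology_of (C_metric T)) euclideanreal F"
  shows "sampled_value T F z = F (restrict z {0..T})"
proof -
  have "limitin (mtopology_of (C_metric T)) (\<lambda>m. bernstein_path T m (sample T m z)) (restrict z {0..T}) sequentially"
    by (intro limitin_C_metric bernstein_path_in_C_metric bernstein_path_uniform_limit T z)
  from continuous_map_limit[OF F this]
  show ?thesis by (auto simp: sampled_value_def comp_def intro: limI)
qed

text \<open>
  Separability of the space of continuous functions, in the form needed here: the path is the limit of
  countably-valued random elements \<open>Q m\<close>, and it lies in an open set \<open>U\<close> iff, for some \<open>k\<close>, the balls of radius
  \<open>1 / (k + 1)\<close> around \<open>Q m\<close> are eventually contained in \<open>U\<close>.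
\<close>

lemma path_borel_measurable:
  assumes T: "0 < T" and Z: "\<And>t. t \<in> {0..T} \<Longrightarrow> Z t \<in> borel_measurable M"
    and cont: "\<And>\<omega>. \<omega> \<in> space M \<Longrightarrow> continuous_on {0..T} (\<lambda>t. Z t \<omega>)"
  shows "(\<lambda>\<omega>. \<lambda>t\<in>{0..T}. Z t \<omega>) \<in> M \<rightarrow>\<^sub>M borel_of (mtopology_of (C_metric T))"
  unfolding borel_of_def
proof (rule measurable_measure_of)
  interpret C: Metric_space "mspace (C_metric T)" "mdist (C_metric T)"
    by (rule Metric_space_mspace_mdist)
  let ?f = "\<lambda>\<omega>. \<lambda>t\<in>{0..T}. Z t \<omega>"
  let ?q = "\<lambda>m \<omega>. bernstein_path T m (sample T m (\<lambda>t. Z t \<omega>))"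
  show "{U. openin (mtopology_of (C_metric T)) U} \<subseteq> Pow (topspace (mtopology_of (C_metric T)))"
    using openin_subset by blast
  have sp: "?f \<omega> \<in> mspace (C_metric T)" if "\<omega> \<in> space M" for \<omega>
    using cont[OF that] by (rule restrict_in_C_metric)
  then show "?f \<in> space M \<rightarrow> topspace (mtopology_of (C_metric T))" by auto
  have lim: "limitin C.mtopology (\<lambda>m. ?q m \<omega>) (?f \<omega>) sequentially" if "\<omega> \<in> space M" for \<omega>
    using limitin_C_metric[of "\<lambda>m. ?q m \<omega>", OF bernstein_path_in_C_metric cont[OF that] bernstein_path_uniform_limit[OF T cont[OF that]]]
    by (simp add: mtopology_of_def)
  fix U assume "U \<in> {U. openin (mtopology_of (C_metric T)) U}"
  then have U: "openin C.mtopology U" by (simp add: mtopology_of_def)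
  \<comment> \<open>The test functions whose ball of radius \<open>1 / (k + 1)\<close> fits into \<open>U\<close>; only the countably many
    rounded Bernstein polynomials are tested for membership.\<close>
  define G where "G k = {q. C.mball q (1 / real (Suc k)) \<subseteq> U}" for k
  have "?f \<omega> \<in> U \<longleftrightarrow> (\<exists>k N. \<forall>m\<ge>N. ?q m \<omega> \<in> G k)" if w: "\<omega> \<in> space M" for \<omega>
  proof
    assume "?f \<omega> \<in> U"
    then obtain r where r: "0 < r" "C.mball (?f \<omega>) r \<subseteq> U" using U by (auto simp: C.openin_mtopology)
    then obtain k where k: "1 / real (Suc k) < r / 2" using nat_approx_posE[of "r / 2"] by auto
    from lim[OF w] r(1) obtain N where N: "\<And>m. N \<le> m \<Longrightarrow> mdist (C_metric T) (?q m \<omega>) (?f \<omega>) < r / 2"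
      unfolding C.limit_metric_sequentially by (metis half_gt_zero)
    have "?q m \<omega> \<in> G k" if "N \<le> m" for m
    proof -
      have "C.mball (?q m \<omega>) (1 / real (Suc k)) \<subseteq> C.mball (?f \<omega>) r"
      proof
        fix g assume g: "g \<in> C.mball (?q m \<omega>) (1 / real (Suc k))"
        then have "g \<in> mspace (C_metric T)" "mdist (C_metric T) (?q m \<omega>) g < r / 2" using k by auto
        moreover have "mdist (C_metric T) (?f \<omega>) g \<le> mdist (C_metric T) (?f \<omega>) (?q m \<omega>) + mdist (C_metric T) (?q m \<omega>) g"
          by (rule C.triangle) (use sp[OF w] bernstein_path_in_C_metric g in auto)
        ultimately show "g \<in> C.mball (?f \<omega>) r"
          using N[OF that] sp[OF w] by (auto simp: C.commute)
      qed
      with r(2) show ?thesis by (auto simp: G_def)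
    qed
    then show "\<exists>k N. \<forall>m\<ge>N. ?q m \<omega> \<in> G k" by blast
  next
    assume "\<exists>k N. \<forall>m\<ge>N. ?q m \<omega> \<in> G k"
    then obtain k N where kN: "\<And>m. N \<le> m \<Longrightarrow> ?q m \<omega> \<in> G k" by auto
    have "0 < 1 / real (Suc k)" by simp
    with lim[OF w] obtain N' where N': "\<And>m. N' \<le> m \<Longrightarrow> mdist (C_metric T) (?q m \<omega>) (?f \<omega>) < 1 / real (Suc k)"
      unfolding C.limit_metric_sequentially by meson
    have "?f \<omega> \<in> C.mball (?q (max N N') \<omega>) (1 / real (Suc k))"
      using N'[of "max N N'"] sp[OF w] bernstein_path_in_C_metric by auto
    then show "?f \<omega> \<in> U" using kN[of "max N N'"] by (auto simp: G_def)
  qed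
  then have eq: "?f -` U \<inter> space M = {\<omega>\<in>space M. \<exists>k N. \<forall>m\<ge>N. ?q m \<omega> \<in> G k}" by blast
  have [measurable]: "Measurable.pred M (\<lambda>\<omega>. ?q m \<omega> \<in> G k)" for m k
    by (rule measurable_compose[OF sample_measurable[OF less_imp_le[OF T] Z]]) auto
  show "?f -` U \<inter> space M \<in> sets M" unfolding eq by measurable
qed

lemma measurable_completion_AE_cong:
  assumes g: "g \<in> M \<rightarrow>\<^sub>M borel" and eq: "AE x in M. f x = g x"
  shows "f \<in> completion M \<rightarrow>\<^sub>M borel"
proof (rule measurableI)
  fix A :: "'b set" assume A: "A \<in> sets borel"
  show "f -` A \<inter> space (completion M) \<in> sets (completion M)"
  proof (rule completion.in_sets_AE)
    show "g -` A \<inter> space M \<in> sets (completion M)" using measurable_sets[OF g A] by auto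
    show "AE x in completion M. (x \<in> g -` A \<inter> space M) = (x \<in> f -` A \<inter> space (completion M))"
      using AE_completion[OF eq] by eventually_elim auto
  qed auto
qed auto

text \<open>
  The set of continuous paths is measurable for the completion, because its complement is contained in a
  null set; off it, the zero path is used.
\<close>

lemma continuous_processI:
  assumes T: "0 < T" and cont: "AE \<omega> in M. continuous_on {0..T} (\<lambda>t. X t \<omega>)"
    and X: "\<And>t. t \<in> {0..T} \<Longrightarrow> X t \<in> borel_measurable (completion M)"
  shows "continuous_process T M X"
  unfolding continuous_process_def
proof
  let ?Z = "\<lambda>t \<omega>. if \<not> continuous_on {0..T} (\<lambda>t. X t \<omega>) then 0 else X t \<omega>"
  have "AE \<omega> in M. \<not> \<not> continuous_on {0..T} (\<lambda>t. X t \<omega>)" using cont by simp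
  from sets_completion_AE[OF this]
  have [measurable]: "Measurable.pred (completion M) (\<lambda>\<omega>. \<not> continuous_on {0..T} (\<lambda>t. X t \<omega>))" .
  have "(\<lambda>\<omega>. \<lambda>t\<in>{0..T}. ?Z t \<omega>) \<in> completion M \<rightarrow>\<^sub>M borel_of (mtopology_of (C_metric T))"
  proof (rule path_borel_measurable[OF T])
    show "?Z t \<in> borel_measurable (completion M)" if "t \<in> {0..T}" for t
      using X[OF that] by measurable
    show "continuous_on {0..T} (\<lambda>t. ?Z t \<omega>)" for \<omega>
      by (cases "continuous_on {0..T} (\<lambda>t. X t \<omega>)") auto
  qed
  also have "(\<lambda>\<omega>. \<lambda>t\<in>{0..T}. ?Z t \<omega>) = path_map T X"
    by (auto simp: path_map_def fun_eq_iff)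
  finally show "path_map T X \<in> completion M \<rightarrow>\<^sub>M borel_of (mtopology_of (C_metric T))" .
qed (rule cont)

lemma continuous_map_measurable:
  assumes "continuous_map X euclideanreal F"
  shows "F \<in> borel_measurable (borel_of X)"
proof (rule borel_measurableI)
  fix S :: "real set" assume "open S"
  then have "openin X {x \<in> topspace X. F x \<in> S}"
    using openin_continuous_map_preimage[OF assms, of S] by simp
  moreover have "F -` S \<inter> space (borel_of X) = {x \<in> topspace X. F x \<in> S}"
    by (auto simp: borel_of_def space_measure_of_conv)
  ultimately show "F -` S \<inter> space (borel_of X) \<in> sets (borel_of X)"
    by (auto simp: borel_of_def dest: openin_subset)
qed

text \<open>
  The value of \<open>F\<close> at the path is measurable for the completion only.  Replacing it by an almost surely equal
  \<open>G\<close> that is measurable for \<open>M\<close> prepares the comparison with another probability space.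
\<close>

lemma path_law_integral:
  assumes T: "0 < T" and X: "continuous_process T M X"
    and F: "continuous_map (mtopology_of (C_metric T)) euclideanreal F"
    and G: "G \<in> borel_measurable M" "AE \<omega> in M. sampled_value T F (\<lambda>t. X t \<omega>) = G \<omega>"
  shows "(\<integral>x. F x \<partial>path_law T M X) = (\<integral>\<omega>. G \<omega> \<partial>M)"
proof -
  have pm: "path_map T X \<in> completion M \<rightarrow>\<^sub>M borel_of (mtopology_of (C_metric T))"
    and ae: "AE \<omega> in M. continuous_on {0..T} (\<lambda>t. X t \<omega>)"
    using X by (auto simp: continuous_process_def)
  have "AE \<omega> in M. F (path_map T X \<omega>) = G \<omega>"
    using ae G(2) by eventually_elim (simp add: sampled_value_eq[OF T _ F] path_map_def)
  then have "AE \<omega> in completion M. F (path_map T X \<omega>) = G \<omega>" by (rule AE_completion)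
  then have "(\<integral>\<omega>. F (path_map T X \<omega>) \<partial>completion M) = (\<integral>\<omega>. G \<omega> \<partial>completion M)"
    by (intro integral_cong_AE measurable_compose[OF pm continuous_map_measurable[OF F]] measurable_completion G(1))
  then show ?thesis
    unfolding path_law_def by (simp add: integral_distr[OF pm continuous_map_measurable[OF F]] integral_completion[OF G(1)])
qed


section \<open>Time-changed Wiener processes\<close>

lemma time_changed_clock:
  assumes "clock (\<lambda>u. additive_functional (\<lambda>x. 1 / g x) W u \<omega>)" "0 \<le> t"
  shows "time_changed g W t \<omega> = W (clock_inv (\<lambda>u. additive_functional (\<lambda>x. 1 / g x) W u \<omega>) t) \<omega>"
  using right_inverse_time_clock[where S="additive_functional (\<lambda>x. 1 / g x) W" and \<omega>=\<omega>, OF assms] by (simp add: time_changed_def)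

lemma time_changed_continuous:
  assumes S: "clock (\<lambda>u. additive_functional (\<lambda>x. 1 / g x) W u \<omega>)"
    and W: "continuous_on {0..} (\<lambda>s. W s \<omega>)"
  shows "continuous_on {0..T} (\<lambda>t. time_changed g W t \<omega>)"
proof -
  let ?S = "\<lambda>u. additive_functional (\<lambda>x. 1 / g x) W u \<omega>"
  have "continuous_on {0..T} (clock_inv ?S)"
    by (rule continuous_on_subset[OF clock_inv_continuous[OF S]]) simp
  moreover have "clock_inv ?S ` {0..T} \<subseteq> {0..}"
    using clock_inv(1)[OF S] by (intro image_subsetI) simp
  ultimately have "continuous_on {0..T} (\<lambda>t. W (clock_inv ?S t) \<omega>)"
    by (rule continuous_on_compose2[where g="\<lambda>s. W s \<omega>", OF W])
  then show ?thesis
    by (rule continuous_on_eq) (simp add: time_changed_clock[where W=W and \<omega>=\<omega>, OF S])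
qed

text \<open>
  On continuous paths the time change is a measurable functional of the path of \<open>W\<close>, and the clock condition
  makes it continuous in time.  The process \<open>X\<close> need only agree with the time change almost surely on \<open>{0..T}\<close>; this covers both the rescaled processes and
  the limit, whose definition uses the inverse of \<open>eta\<close> instead of the right inverse.
\<close>

lemma time_changed_process:
  assumes W: "standard_wiener M W" and g: "(\<lambda>x. 1 / g x) \<in> borel_measurable borel"
    and b: "\<And>x. 0 \<le> 1 / g x" "\<And>x. 1 / g x \<le> C"
    and S: "AE \<omega> in M. clock (\<lambda>u. additive_functional (\<lambda>x. 1 / g x) W u \<omega>)"
    and T: "0 < T" and X: "AE \<omega> in M. \<forall>t\<in>{0..T}. X t \<omega> = time_changed g W t \<omega>"
  shows "continuous_process T M X"
    and "continuous_map (mtopology_of (C_metric T)) euclideanreal F \<Longrightarrow>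
      (\<integral>x. F x \<partial>path_law T M X) = (\<integral>\<omega>. sampled_value T F (\<lambda>t. time_changed g dyadic_eval t (path_of W \<omega>)) \<partial>M)"
proof -
  have eq: "AE \<omega> in M. \<forall>t\<in>{0..T}. X t \<omega> = time_changed g dyadic_eval t (path_of W \<omega>)"
    using X standard_wiener_continuous[OF W]
    by eventually_elim (simp add: time_changed_path_of[of W])
  have m: "(\<lambda>\<omega>. time_changed g dyadic_eval t (path_of W \<omega>)) \<in> borel_measurable M" for t
    by (rule measurable_compose[OF path_of_measurable[OF W] time_changed_dyadic_eval_measurable[OF g b]])
  show cp: "continuous_process T M X"
  proof (rule continuous_processI[OF T])
    show "AE \<omega> in M. continuous_on {0..T} (\<lambda>t. X t \<omega>)"
      using X S standard_wiener_continuous[OF W]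
    proof eventually_elim
      case (elim \<omega>)
      from time_changed_continuous[where W=W and \<omega>=\<omega>, OF elim(2,3), of T] show ?case
        by (rule continuous_on_eq) (use elim(1) in simp)
    qed
    show "X t \<in> borel_measurable (completion M)" if "t \<in> {0..T}" for t
      by (rule measurable_completion_AE_cong[OF m[of t]]) (use eq that in \<open>auto elim: eventually_mono\<close>)
  qed
  show "(\<integral>x. F x \<partial>path_law T M X) = (\<integral>\<omega>. sampled_value T F (\<lambda>t. time_changed g dyadic_eval t (path_of W \<omega>)) \<partial>M)"
    if F: "continuous_map (mtopology_of (C_metric T)) euclideanreal F"
  proof (rule path_law_integral[OF T cp F])
    show "(\<lambda>\<omega>. sampled_value T F (\<lambda>t. time_changed g dyadic_eval t (path_of W \<omega>))) \<in> borel_measurable M"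
      using T m by (intro sampled_value_measurable) auto
    show "AE \<omega> in M. sampled_value T F (\<lambda>t. X t \<omega>) = sampled_value T F (\<lambda>t. time_changed g dyadic_eval t (path_of W \<omega>))"
      using eq by eventually_elim (use T in \<open>auto intro!: sampled_value_cong\<close>)
  qed
qed

text \<open>
  Along convergent times the inverse clocks converge, and so do the values of the continuous path \<open>W\<close> there.
\<close>

lemma time_changed_uniform_limit:
  assumes S: "\<And>n. clock (\<lambda>u. additive_functional (\<lambda>x. 1 / g n x) W u \<omega>)"
    and S': "clock (\<lambda>u. additive_functional (\<lambda>x. 1 / h x) W u \<omega>)"
    and conv: "\<And>u. 0 \<le> u \<Longrightarrow> (\<lambda>n. additive_functional (\<lambda>x. 1 / g n x) W u \<omega>)
        \<longlonglongrightarrow> additive_functional (\<lambda>x. 1 / h x) W u \<omega>"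
    and W: "continuous_on {0..} (\<lambda>s. W s \<omega>)"
  shows "uniform_limit {0..T} (\<lambda>n t. time_changed (g n) W t \<omega>) (\<lambda>t. time_changed h W t \<omega>) sequentially"
proof (rule uniform_limit_of_continuous_convergence)
  show "continuous_on {0..T} (\<lambda>t. time_changed h W t \<omega>)"
    by (rule time_changed_continuous[where W=W and \<omega>=\<omega>, OF S' W])
  fix r :: "nat \<Rightarrow> nat" and x :: "nat \<Rightarrow> real" and a :: real
  assume r: "strict_mono r" and x: "\<And>n. x n \<in> {0..T}" "a \<in> {0..T}" "x \<longlonglongrightarrow> a"
  let ?S = "\<lambda>n u. additive_functional (\<lambda>x. 1 / g n x) W u \<omega>"
  have pos: "0 \<le> x n" "0 \<le> a" for n using x by auto
  have "(\<lambda>n. clock_inv (?S (r n)) (x n)) \<longlonglongrightarrow> clock_inv (\<lambda>u. additive_functional (\<lambda>x. 1 / h x) W u \<omega>) a"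
    by (rule clock_inv_tendsto[OF S S'])
      (use pos x(3) LIMSEQ_subseq_LIMSEQ[OF conv r] in \<open>auto simp: comp_def\<close>)
  then have "(\<lambda>n. W (clock_inv (?S (r n)) (x n)) \<omega>)
      \<longlonglongrightarrow> W (clock_inv (\<lambda>u. additive_functional (\<lambda>x. 1 / h x) W u \<omega>) a) \<omega>"
    by (rule continuous_on_tendsto_compose[OF W]) (use clock_inv(1)[OF S' pos(2)] clock_inv(1)[OF S pos(1)] in auto)
  then show "(\<lambda>n. time_changed (g (r n)) W (x n) \<omega>) \<longlonglongrightarrow> time_changed h W a \<omega>"
    by (simp add: time_changed_clock[where W=W and \<omega>=\<omega>, OF S pos(1)] time_changed_clock[where W=W and \<omega>=\<omega>, OF S' pos(2)])
qed simp


section \<open>Speeds with a limit on each side\<close>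

text \<open>
  The lower bound \<open>c\<close> keeps the rate \<open>1 / lam\<close> bounded, uniformly over all spatial rescalings of \<open>lam\<close>;
  this is the bound under which the clocks converge by dominated convergence.
\<close>

locale two_sided_speed =
  fixes lam :: "real \<Rightarrow> real" and a_plus a_minus c :: real
  assumes lam_measurable: "lam \<in> borel_measurable borel"
    and a_plus: "0 < a_plus" and a_minus: "0 < a_minus"
    and lam_at_top: "(lam \<longlongrightarrow> a_plus) at_top" and lam_at_bot: "(lam \<longlongrightarrow> a_minus) at_bot"
    and c: "0 < c" and lam_ge: "\<And>x. c \<le> lam x"
begin

lemma rate_measurable: "(\<lambda>x. 1 / lam (a * x)) \<in> borel_measurable borel"
  using lam_measurable by measurable

lemma rate_pos: "0 < 1 / lam x"
  using c lam_ge[of x] by simp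

lemma rate_le: "1 / lam x \<le> 1 / c"
  using c lam_ge[of x] by (intro divide_left_mono) auto

lemma nu_measurable: "nu a_plus a_minus \<in> borel_measurable borel"
  unfolding nu_def[abs_def] by measurable

lemma nu_pos: "x \<noteq> 0 \<Longrightarrow> min (1 / a_plus) (1 / a_minus) \<le> nu a_plus a_minus x"
  by (cases "0 < x") (auto simp: nu_def indicator_def)

lemma nu_nonneg: "0 \<le> nu a_plus a_minus x"
  using a_plus a_minus by (auto simp: nu_def indicator_def)

lemma nu_le: "nu a_plus a_minus x \<le> 1 / a_plus + 1 / a_minus"
  using a_plus a_minus by (auto simp: nu_def indicator_def)

text \<open>
  At \<open>x \<noteq> 0\<close> the argument \<open>sqrt n * x\<close> runs off to infinity on the side of \<open>x\<close>.  The index is shifted to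
  avoid \<open>n = 0\<close>.
\<close>

lemma rescaled_rate_tendsto:
  assumes x: "x \<noteq> 0"
  shows "(\<lambda>n. 1 / lam (sqrt (real (Suc n)) * x)) \<longlonglongrightarrow> nu a_plus a_minus x"
proof -
  have top: "filterlim (\<lambda>n. sqrt (real (Suc n))) at_top sequentially"
    by (intro filterlim_compose[OF sqrt_at_top] filterlim_compose[OF filterlim_real_sequentially] filterlim_Suc)
  show ?thesis
  proof (cases "0 < x")
    case True
    have "filterlim (\<lambda>n. sqrt (real (Suc n)) * x) at_top sequentially"
      using filterlim_tendsto_pos_mult_at_top[OF tendsto_const True top] by (simp add: mult.commute)
    from filterlim_compose[OF lam_at_top this] a_plus
    have "(\<lambda>n. 1 / lam (sqrt (real (Suc n)) * x)) \<longlonglongrightarrow> 1 / a_plus"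
      by (intro tendsto_divide tendsto_const) auto
    with True show ?thesis by (simp add: nu_def)
  next
    case False
    then have neg: "x < 0" using x by simp
    have "filterlim (\<lambda>n. sqrt (real (Suc n)) * x) at_bot sequentially"
      using filterlim_tendsto_neg_mult_at_bot[OF tendsto_const neg top] by (simp add: mult.commute)
    from filterlim_compose[OF lam_at_bot this] a_minus
    have "(\<lambda>n. 1 / lam (sqrt (real (Suc n)) * x)) \<longlonglongrightarrow> 1 / a_minus"
      by (intro tendsto_divide tendsto_const) auto
    with neg show ?thesis by (simp add: nu_def)
  qed
qed

text \<open>
  Off \<open>0\<close> the rate \<open>nu\<close> is at least \<open>min (1 / a_plus) (1 / a_minus)\<close>, so that \<open>eta\<close> grows at least linearly.
\<close>

lemma eta_clock:
  assumes W: "continuous_on {0..} (\<lambda>s. W s \<omega>)" and nz: "AE s in lborel. 0 < s \<longrightarrow> W s \<omega> \<noteq> 0"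
  shows "clock (\<lambda>u. eta a_plus a_minus W u \<omega>)"
  unfolding eta_def
proof (rule additive_functional_clock[where W=W and \<omega>=\<omega>, OF nu_measurable nu_nonneg nu_le W])
  define m where "m = min (1 / a_plus) (1 / a_minus)"
  have m: "0 < m" using a_plus a_minus by (simp add: m_def)
  have ge: "AE s in lborel. 0 < s \<longrightarrow> m \<le> nu a_plus a_minus (W s \<omega>)"
    using nz by eventually_elim (auto simp: m_def intro: nu_pos)
  then show "AE s in lborel. 0 < s \<longrightarrow> 0 < nu a_plus a_minus (W s \<omega>)"
    by eventually_elim (use m in auto)
  fix t :: real
  \<comment> \<open>Chosen so that the linear lower bound \<open>m * u\<close> exceeds \<open>t\<close>.\<close>
  define u where "u = (\<bar>t\<bar> + 1) / m"
  have u: "0 \<le> u" using m by (simp add: u_def)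
  note inc = additive_functional_increment[where W=W and \<omega>=\<omega>, OF nu_measurable nu_nonneg nu_le W order_refl u]
  have "m * u = (LINT s:{0<..u}|lborel. m)" using u by (simp add: set_lebesgue_integral_def)
  also have "\<dots> \<le> (LINT s:{0<..u}|lborel. nu a_plus a_minus (W s \<omega>))"
    by (rule set_integral_mono_AE) (use inc(1) ge u in \<open>auto simp: set_integrable_def\<close>)
  also have "\<dots> = additive_functional (nu a_plus a_minus) W u \<omega> - additive_functional (nu a_plus a_minus) W 0 \<omega>"
    by (rule inc(2)[symmetric])
  also have "\<dots> \<le> additive_functional (nu a_plus a_minus) W u \<omega>"
    unfolding additive_functional_def set_lebesgue_integral_def
    using nu_nonneg by (simp add: integral_nonneg_AE)
  finally have "\<bar>t\<bar> + 1 \<le> additive_functional (nu a_plus a_minus) W u \<omega>" using m by (simp add: u_def)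
  with u show "\<exists>u\<ge>0. t < additive_functional (nu a_plus a_minus) W u \<omega>" by (intro exI[of _ u]) auto
qed

lemma rescaled_functional_tendsto:
  assumes W: "continuous_on {0..} (\<lambda>s. W s \<omega>)" and nz: "AE s in lborel. 0 < s \<longrightarrow> W s \<omega> \<noteq> 0"
  shows "(\<lambda>n. additive_functional (\<lambda>x. 1 / lam (sqrt (real (Suc n)) * x)) W u \<omega>)
    \<longlonglongrightarrow> eta a_plus a_minus W u \<omega>"
  unfolding eta_def
  by (rule additive_functional_tendsto[where W=W and \<omega>=\<omega> and k="\<lambda>n x. 1 / lam (sqrt (real (Suc n)) * x)", OF rate_measurable less_imp_le[OF rate_pos] rate_le nu_measurable rescaled_rate_tendsto W nz])

text \<open>
  With indices shifted by one to avoid \<open>n = 0\<close>, let \<open>f n = exp (- S n)\<close> for the clock \<open>S\<close> of \<open>B\<close>.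
  By scaling, \<open>f n\<close> has the expectation of \<open>h n = exp (- n * S\<^sub>n 1)\<close>, where \<open>S\<^sub>n\<close> is the clock for the speed \<open>lam (sqrt n * x)\<close>; since
  \<open>S\<^sub>n 1\<close> converges to \<open>eta 1 > 0\<close>, these expectations tend to \<open>0\<close>.  But \<open>f n\<close> decreases to a
  nonnegative limit, which is therefore \<open>0\<close> almost surely.
\<close>

lemma occupation_clock_unbounded:
  assumes B: "standard_wiener M B"
  shows "AE \<omega> in M. \<forall>t. \<exists>u\<ge>0. t < additive_functional (\<lambda>x. 1 / lam x) B u \<omega>"
proof -
  interpret prob_space M using standard_wiener_prob_space[OF B] .
  note [measurable] = path_of_measurable[OF B] rate_measurable
  have [measurable]: "(\<lambda>x. 1 / lam x) \<in> borel_measurable borel" using lam_measurable by measurable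
  let ?A = "\<lambda>n. additive_functional (\<lambda>x. 1 / lam x) dyadic_eval (real (Suc n))"
  let ?D = "\<lambda>n w. real (Suc n) * additive_functional (\<lambda>x. 1 / lam (sqrt (real (Suc n)) * x)) dyadic_eval 1 w"
  define f where "f n \<omega> = exp (- ?A n (path_of B \<omega>))" for n \<omega>
  define h where "h n \<omega> = exp (- ?D n (path_of B \<omega>))" for n \<omega>
  have [measurable]: "f n \<in> borel_measurable M" "h n \<in> borel_measurable M" for n
    unfolding f_def[abs_def] h_def[abs_def] by measurable
  have nonneg: "0 \<le> additive_functional k W u w" if "\<And>x. 0 \<le> k x" for k W u and w :: 'z
    unfolding additive_functional_def set_lebesgue_integral_def using that by (intro integral_nonneg_AE) auto
  have scaled: "(\<integral>\<omega>. f n \<omega> \<partial>M) = (\<integral>\<omega>. h n \<omega> \<partial>M)" for n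
  proof -
    let ?B = "\<lambda>s \<omega>. B (real (Suc n) * s) \<omega> / sqrt (real (Suc n))"
    have Bn: "standard_wiener M ?B" by (rule wiener_scaling[OF B]) simp
    have "AE \<omega> in M. f n \<omega> = exp (- ?D n (path_of ?B \<omega>))"
      using standard_wiener_continuous[OF B] standard_wiener_continuous[OF Bn]
    proof eventually_elim
      case (elim \<omega>)
      have "?A n (path_of B \<omega>) = additive_functional (\<lambda>x. 1 / lam x) B (real (Suc n) * 1) \<omega>"
        using additive_functional_path_of[where W=B and \<omega>=\<omega>, OF elim(1)] by simp
      also have "\<dots> = real (Suc n) * additive_functional (\<lambda>x. 1 / lam (sqrt (real (Suc n)) * x)) ?B 1 \<omega>"
        by (rule additive_functional_scaling) simp
      also have "\<dots> = ?D n (path_of ?B \<omega>)"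
        by (subst additive_functional_path_of[where W="?B" and \<omega>=\<omega>, OF elim(2)]) simp
      finally show ?case by (simp only: f_def)
    qed
    then have "(\<integral>\<omega>. f n \<omega> \<partial>M) = (\<integral>\<omega>. exp (- ?D n (path_of ?B \<omega>)) \<partial>M)"
      by (intro integral_cong_AE) (use path_of_measurable[OF Bn] in measurable)
    also have "\<dots> = (\<integral>\<omega>. h n \<omega> \<partial>M)"
      unfolding h_def by (rule wiener_integral_unique[OF Bn B]) measurable
    finally show ?thesis .
  qed
  have "(\<lambda>n. \<integral>\<omega>. h n \<omega> \<partial>M) \<longlonglongrightarrow> (\<integral>\<omega>. 0 \<partial>M)"
  proof (rule integral_dominated_convergence[where w="\<lambda>_. 1"])
    show "AE \<omega> in M. (\<lambda>n. h n \<omega>) \<longlonglongrightarrow> 0"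
      using standard_wiener_continuous[OF B] wiener_ae_nonzero[OF B]
    proof eventually_elim
      case (elim \<omega>)
      have "clock (\<lambda>u. eta a_plus a_minus B u \<omega>)" by (rule eta_clock[where W=B and \<omega>=\<omega>, OF elim])
      then have pos: "0 < eta a_plus a_minus B 1 \<omega>"
        using clock_less_iff[of "\<lambda>u. eta a_plus a_minus B u \<omega>" 0 1] by (simp add: clock_def)
      have "filterlim (\<lambda>n. ?D n (path_of B \<omega>)) at_top sequentially"
        unfolding additive_functional_path_of[where W=B and \<omega>=\<omega>, OF elim(1)]
        by (subst mult.commute)
          (rule filterlim_tendsto_pos_mult_at_top[OF rescaled_functional_tendsto[where W=B and \<omega>=\<omega>, OF elim] pos
              filterlim_compose[OF filterlim_real_sequentially filterlim_Suc]])
      then have "filterlim (\<lambda>n. - ?D n (path_of B \<omega>)) at_bot sequentially"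
        by (simp only: filterlim_uminus_at_bot minus_minus)
      from filterlim_compose[OF exp_at_bot this] show ?case by (simp only: h_def)
    qed
    show "AE \<omega> in M. norm (h n \<omega>) \<le> 1" for n
    proof -
      have "0 \<le> ?D n w" for w
        by (intro mult_nonneg_nonneg nonneg less_imp_le[OF rate_pos]) simp
      then show ?thesis by (simp add: h_def)
    qed
  qed auto
  then have f0: "(\<lambda>n. \<integral>\<omega>. f n \<omega> \<partial>M) \<longlonglongrightarrow> 0" by (simp add: scaled)
  define g where "g \<omega> = lim (\<lambda>n. f n \<omega>)" for \<omega>
  have [measurable]: "g \<in> borel_measurable M" unfolding g_def[abs_def] by measurable
  have lim: "AE \<omega> in M. (\<lambda>n. f n \<omega>) \<longlonglongrightarrow> g \<omega>"
    using standard_wiener_continuous[OF B]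
  proof eventually_elim
    case (elim \<omega>)
    have "decseq (\<lambda>n. f n \<omega>)"
    proof (rule decseq_SucI)
      fix n
      have "0 \<le> real (Suc n)" "real (Suc n) \<le> real (Suc (Suc n))" by auto
      from additive_functional_lipschitz(1)[where W=B and \<omega>=\<omega>,
          OF _ less_imp_le[OF rate_pos] rate_le elim this]
      show "f (Suc n) \<omega> \<le> f n \<omega>"
        unfolding f_def additive_functional_path_of[where W=B and \<omega>=\<omega>, OF elim] by simp
    qed
    then obtain L where "(\<lambda>n. f n \<omega>) \<longlonglongrightarrow> L"
      by (rule decseq_convergent[where B=0]) (auto simp: f_def)
    then show ?case by (simp add: g_def limI)
  qed
  have f1: "0 \<le> f n \<omega>" "f n \<omega> \<le> 1" for n \<omega>
    using nonneg[of "\<lambda>x. 1 / lam x"] rate_pos by (auto simp: f_def less_imp_le)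
  have conv: "(\<lambda>n. \<integral>\<omega>. f n \<omega> \<partial>M) \<longlonglongrightarrow> (\<integral>\<omega>. g \<omega> \<partial>M)"
    by (rule integral_dominated_convergence[where w="\<lambda>_. 1"]) (use lim f1 in auto)
  with f0 have "(\<integral>\<omega>. g \<omega> \<partial>M) = 0" by (rule LIMSEQ_unique[rotated])
  have gb: "AE \<omega> in M. 0 \<le> g \<omega> \<and> g \<omega> \<le> 1"
    using lim by eventually_elim (use f1 in \<open>auto intro: LIMSEQ_le_const LIMSEQ_le_const2\<close>)
  then have "integrable M g"
    by (intro integrable_const_bound[where B=1]) (auto elim: eventually_mono)
  with gb \<open>(\<integral>\<omega>. g \<omega> \<partial>M) = 0\<close> have "AE \<omega> in M. g \<omega> = 0"
    by (subst (asm) integral_nonneg_eq_0_iff_AE) (auto elim: eventually_mono)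
  with lim standard_wiener_continuous[OF B] show ?thesis
  proof eventually_elim
    case (elim \<omega>)
    show ?case
    proof
      fix t
      from elim(1,3) have "\<forall>\<^sub>F n in sequentially. f n \<omega> < exp (- t)"
        by (intro order_tendstoD(2)[where y=0]) auto
      then obtain n where "f n \<omega> < exp (- t)" by (auto simp: eventually_sequentially)
      then have "t < additive_functional (\<lambda>x. 1 / lam x) B (real (Suc n)) \<omega>"
        unfolding f_def additive_functional_path_of[where W=B and \<omega>=\<omega>, OF elim(2)] by simp
      then show "\<exists>u\<ge>0. t < additive_functional (\<lambda>x. 1 / lam x) B u \<omega>"
        by (intro exI[of _ "real (Suc n)"]) auto
    qed
  qed
qed

text \<open>
  All hypotheses, including the limits and the lower bound, survive a spatial rescaling; hence
  whatever is proved for \<open>lam\<close> holds for every \<open>lam (sqrt n * x)\<close>.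
\<close>

lemma rescale: "0 < a \<Longrightarrow> two_sided_speed (\<lambda>x. lam (a * x)) a_plus a_minus c"
proof unfold_locales
  assume a: "0 < a"
  show "(\<lambda>x. lam (a * x)) \<in> borel_measurable borel" using lam_measurable by measurable
  show "((\<lambda>x. lam (a * x)) \<longlongrightarrow> a_plus) at_top"
    by (rule filterlim_compose[OF lam_at_top filterlim_tendsto_pos_mult_at_top[OF tendsto_const a filterlim_ident]])
  have "filterlim (\<lambda>x. a * x) at_bot at_bot"
    by (rule filterlim_tendsto_pos_mult_at_bot[OF tendsto_const a filterlim_ident])
  from filterlim_compose[OF lam_at_bot this] show "((\<lambda>x. lam (a * x)) \<longlongrightarrow> a_minus) at_bot" .
qed (use a_plus a_minus c lam_ge in auto)

lemma occupation_clock: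
  assumes B: "standard_wiener M B"
  shows "AE \<omega> in M. clock (\<lambda>u. additive_functional (\<lambda>x. 1 / lam x) B u \<omega>)"
  using occupation_clock_unbounded[OF B] standard_wiener_continuous[OF B]
proof eventually_elim
  case (elim \<omega>)
  have "(\<lambda>x. 1 / lam x) \<in> borel_measurable borel" using rate_measurable[of 1] by simp
  from additive_functional_clock[where W=B and \<omega>=\<omega>, OF this less_imp_le[OF rate_pos] rate_le elim(2)]
  show ?case using elim(1) rate_pos by auto
qed

text \<open>
  Both sides are integrals over the probability space \<open>N\<close>: the limit by definition, and the \<open>n\<close>-th process
  because it is the time change of a rescaled Wiener process, whose law is that of \<open>W\<close>.  There the
  integrands are bounded and converge almost surely, since \<open>F\<close> is continuous and the paths converge uniformly.
\<close>

lemma time_changed_converges_weakly: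
  assumes B: "standard_wiener M B" and W: "standard_wiener N W" and T: "0 < T"
  shows "processes_converge_weakly T
            M (\<lambda>n t \<omega>. time_changed lam B (real n * t) \<omega> / sqrt (real n))
            N (\<lambda>t \<omega>. W (eta_inv a_plus a_minus W t \<omega>) \<omega>)"
proof -
  interpret M: prob_space M using standard_wiener_prob_space[OF B] .
  interpret N: prob_space N using standard_wiener_prob_space[OF W] .
  let ?X = "\<lambda>n t \<omega>. time_changed lam B (real n * t) \<omega> / sqrt (real n)"
  let ?Y = "\<lambda>t \<omega>. W (eta_inv a_plus a_minus W t \<omega>) \<omega>"
  let ?g = "\<lambda>n x. lam (sqrt (real (Suc n)) * x)"
  let ?h = "\<lambda>x. 1 / nu a_plus a_minus x"
  let ?B = "\<lambda>n s \<omega>. B (real (Suc n) * s) \<omega> / sqrt (real (Suc n))"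
  \<comment> \<open>The \<open>n + 1\<close>-st process is the time change of the Wiener process \<open>?B n\<close> with speed \<open>?g n\<close>.\<close>
  have speed: "two_sided_speed (?g n) a_plus a_minus c" for n by (rule rescale) simp
  have Bn: "standard_wiener M (?B n)" for n by (rule wiener_scaling[OF B]) simp
  have X: "?X (Suc n) t \<omega> = time_changed (?g n) (?B n) t \<omega>" for n t \<omega>
    by (rule time_changed_scaling) simp
  have nonneg: "0 \<le> 1 / ?g n x" and le: "1 / ?g n x \<le> 1 / c" for n x
    using rate_pos rate_le by (auto intro: less_imp_le)
  \<comment> \<open>The limit is a time change with speed \<open>1 / nu\<close>; at \<open>0\<close> both \<open>nu\<close> and \<open>1 / (1 / nu)\<close> are \<open>0\<close>.\<close>
  have h: "(\<lambda>x. 1 / ?h x) = nu a_plus a_minus" by auto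
  have eta_ae: "AE \<omega> in N. clock (\<lambda>u. eta a_plus a_minus W u \<omega>)"
    using standard_wiener_continuous[OF W] wiener_ae_nonzero[OF W]
    by eventually_elim (rule eta_clock)
  have eta_ae': "AE \<omega> in N. clock (\<lambda>u. additive_functional (\<lambda>x. 1 / ?h x) W u \<omega>)"
    using eta_ae unfolding h eta_def .
  have Y: "AE \<omega> in N. \<forall>t\<in>{0..T}. ?Y t \<omega> = time_changed ?h W t \<omega>"
    using eta_ae'
  proof eventually_elim
    case (elim \<omega>)
    show ?case
      using time_changed_clock[where W=W and \<omega>=\<omega>, OF elim] by (auto simp: h eta_inv_def eta_def clock_inv_def)
  qed
  have hm: "(\<lambda>x. 1 / ?h x) \<in> borel_measurable borel" "\<And>x. 0 \<le> 1 / ?h x" "\<And>x. 1 / ?h x \<le> 1 / a_plus + 1 / a_minus"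
    using nu_measurable nu_nonneg nu_le by (auto simp: h)
  have Xae: "AE \<omega> in M. \<forall>t\<in>{0..T}. ?X (Suc n) t \<omega> = time_changed (?g n) (?B n) t \<omega>" for n
    by (intro AE_I2 ballI X)
  note Xp = time_changed_process[OF Bn rate_measurable nonneg le two_sided_speed.occupation_clock[OF speed Bn] T Xae]
  note Yp = time_changed_process[OF W hm eta_ae' T Y]
  have cpX: "continuous_process T M (?X n)" for n
  proof (cases n)
    case 0
    \<comment> \<open>For \<open>n = 0\<close> division by \<open>sqrt 0 = 0\<close> makes the process identically \<open>0\<close>.\<close>
    show ?thesis unfolding 0 by (rule continuous_processI[OF T]) auto
  next
    case (Suc k)
    show ?thesis unfolding Suc by (rule Xp(1))
  qed
  have "weak_conv_on (mtopology_of (C_metric T)) (\<lambda>n. path_law T M (?X n)) (path_law T N ?Y)"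
    unfolding weak_conv_on_def
  proof (intro allI impI)
    fix F :: "(real \<Rightarrow> real) \<Rightarrow> real"
    assume "continuous_map (mtopology_of (C_metric T)) euclideanreal F \<and> bounded (F ` topspace (mtopology_of (C_metric T)))"
    then have F: "continuous_map (mtopology_of (C_metric T)) euclideanreal F"
      and "bounded (F ` mspace (C_metric T))" by auto
    then obtain K where K: "\<And>x. x \<in> mspace (C_metric T) \<Longrightarrow> \<bar>F x\<bar> \<le> K"
      by (auto simp: bounded_iff)
    let ?\<Phi> = "\<lambda>g w. sampled_value T F (\<lambda>t. time_changed g dyadic_eval t w)"
    have [measurable]: "?\<Phi> (?g n) \<in> borel_measurable path_space" for n
      using T by (intro sampled_value_measurable time_changed_dyadic_eval_measurable[OF rate_measurable nonneg le]) auto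
    have [measurable]: "?\<Phi> ?h \<in> borel_measurable path_space"
      using T by (intro sampled_value_measurable time_changed_dyadic_eval_measurable[OF hm]) auto
    note [measurable] = path_of_measurable[OF W]
    have good: "AE \<omega> in N. \<forall>n. clock (\<lambda>u. additive_functional (\<lambda>x. 1 / ?g n x) W u \<omega>)"
      unfolding AE_all_countable by (intro allI two_sided_speed.occupation_clock[OF speed W])
    have val: "?\<Phi> g (path_of W \<omega>) = F (\<lambda>t\<in>{0..T}. time_changed g W t \<omega>)"
      if "clock (\<lambda>u. additive_functional (\<lambda>x. 1 / g x) W u \<omega>)" "continuous_on {0..} (\<lambda>s. W s \<omega>)" for g \<omega>
      using sampled_value_eq[OF T time_changed_continuous[where W=W and \<omega>=\<omega>, OF that] F]
      by (simp add: time_changed_path_of[where W=W and \<omega>=\<omega>, OF that(2)])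
    have "(\<lambda>n. \<integral>\<omega>. ?\<Phi> (?g n) (path_of W \<omega>) \<partial>N) \<longlonglongrightarrow> (\<integral>\<omega>. ?\<Phi> ?h (path_of W \<omega>) \<partial>N)"
    proof (rule integral_dominated_convergence[where w="\<lambda>_. K"])
      show "AE \<omega> in N. (\<lambda>n. ?\<Phi> (?g n) (path_of W \<omega>)) \<longlonglongrightarrow> ?\<Phi> ?h (path_of W \<omega>)"
        using good eta_ae' standard_wiener_continuous[OF W] wiener_ae_nonzero[OF W]
      proof eventually_elim
        case (elim \<omega>)
        note S = elim(1)[rule_format] and cont = elim(3)
        have "uniform_limit {0..T} (\<lambda>n t. time_changed (?g n) W t \<omega>) (\<lambda>t. time_changed ?h W t \<omega>) sequentially"
        proof (rule time_changed_uniform_limit[where W=W and \<omega>=\<omega>, OF S elim(2) _ cont])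
          show "(\<lambda>n. additive_functional (\<lambda>x. 1 / ?g n x) W u \<omega>) \<longlonglongrightarrow> additive_functional (\<lambda>x. 1 / ?h x) W u \<omega>" for u
            using rescaled_functional_tendsto[where W=W and \<omega>=\<omega>, OF elim(3,4)] unfolding h eta_def .
        qed
        then have "uniform_limit {0..T} (\<lambda>n. \<lambda>t\<in>{0..T}. time_changed (?g n) W t \<omega>) (\<lambda>t. time_changed ?h W t \<omega>) sequentially"
          by (simp add: uniform_limit_iff)
        then have "limitin (mtopology_of (C_metric T)) (\<lambda>n. \<lambda>t\<in>{0..T}. time_changed (?g n) W t \<omega>)
            (\<lambda>t\<in>{0..T}. time_changed ?h W t \<omega>) sequentially"
          by (intro limitin_C_metric restrict_in_C_metric time_changed_continuous[where W=W and \<omega>=\<omega>] S elim(2) cont)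
        from continuous_map_limit[OF F this] show ?case
          by (simp only: val[OF S cont] val[OF elim(2) cont] comp_def limitin_canonical_iff)
      qed
      show "AE \<omega> in N. norm (?\<Phi> (?g n) (path_of W \<omega>)) \<le> K" for n
        using good standard_wiener_continuous[OF W]
      proof eventually_elim
        case (elim \<omega>)
        note S = elim(1)[rule_format]
        show ?case unfolding val[OF S elim(2)] real_norm_def
          by (intro K restrict_in_C_metric time_changed_continuous[where W=W and \<omega>=\<omega>] S elim(2))
      qed
    qed measurable
    moreover have "(\<integral>x. F x \<partial>path_law T M (?X (Suc n))) = (\<integral>\<omega>. ?\<Phi> (?g n) (path_of W \<omega>) \<partial>N)" for n
    proof -
      have "(\<integral>x. F x \<partial>path_law T M (?X (Suc n))) = (\<integral>\<omega>. ?\<Phi> (?g n) (path_of (?B n) \<omega>) \<partial>M)"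
        by (rule Xp(2)[OF F])
      also have "\<dots> = (\<integral>\<omega>. ?\<Phi> (?g n) (path_of W \<omega>) \<partial>N)"
        by (rule wiener_integral_unique[OF Bn W]) measurable
      finally show ?thesis .
    qed
    ultimately have "(\<lambda>n. \<integral>x. F x \<partial>path_law T M (?X (Suc n))) \<longlonglongrightarrow> (\<integral>x. F x \<partial>path_law T N ?Y)"
      by (simp only: Yp(2)[OF F])
    then show "(\<lambda>n. \<integral>x. F x \<partial>path_law T M (?X n)) \<longlonglongrightarrow> (\<integral>x. F x \<partial>path_law T N ?Y)"
      \<comment> \<open>Scaling is available for \<open>n \<ge> 1\<close> only; the term at \<open>0\<close> is irrelevant for the limit.\<close>
      by (rule LIMSEQ_imp_Suc)
  qed
  with cpX Yp(1) show ?thesis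
    unfolding processes_converge_weakly_def by blast
qed

end

theorem theorem2p3:
  fixes lam :: "real \<Rightarrow> real" and a_plus a_minus c :: real
    and M :: "'a measure" and B :: "real \<Rightarrow> 'a \<Rightarrow> real"
    and N :: "'b measure" and W :: "real \<Rightarrow> 'b \<Rightarrow> real"
  assumes "lam \<in> borel_measurable borel"
    and "\<And>x. lam x > 0"
    and "\<And>K. compact K \<Longrightarrow> set_integrable lborel K (\<lambda>x. 1 / lam x)"
    and "a_plus > 0" and "a_minus > 0"
    and "(lam \<longlongrightarrow> a_plus) at_top"
    and "(lam \<longlongrightarrow> a_minus) at_bot"
    and "c > 0" and "\<And>x. lam x \<ge> c"
    and "standard_wiener M B"
    and "standard_wiener N W"
  shows "(AE \<omega> in N. continuous_on {0..} (\<lambda>t. eta a_plus a_minus W t \<omega>) \<and>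
            strict_mono_on {0..} (\<lambda>t. eta a_plus a_minus W t \<omega>)) \<and>
         (\<forall>T>0. processes_converge_weakly T
            M (\<lambda>n t \<omega>. time_changed lam B (real n * t) \<omega> / sqrt (real n))
            N (\<lambda>t \<omega>. W (eta_inv a_plus a_minus W t \<omega>) \<omega>))"
proof -
  interpret two_sided_speed lam a_plus a_minus c
    using assms(1,4-9) by unfold_locales
  have "AE \<omega> in N. clock (\<lambda>u. eta a_plus a_minus W u \<omega>)"
    using standard_wiener_continuous[OF assms(11)] wiener_ae_nonzero[OF assms(11)]
    by eventually_elim (rule eta_clock)
  then have "AE \<omega> in N. continuous_on {0..} (\<lambda>t. eta a_plus a_minus W t \<omega>) \<and>
            strict_mono_on {0..} (\<lambda>t. eta a_plus a_minus W t \<omega>)"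
    by eventually_elim (simp add: clock_def)
  with time_changed_converges_weakly[OF assms(10,11)] show ?thesis by blast
qed

end
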